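(* Let $v_1,v_2\in L_2(-\infty,+\infty)$ and $\alpha\in[0,2\pi)$. Let $A(v_1,v_2,\alpha)$ act by $$A(v_1,v_2,\alpha)\psi(x)=i\psi'(x)+v_1(x)\Big[\psi(-0)+\tfrac{i}{2}\langle\psi,v_1\rangle\Big]+v_2(x)\Big[\psi(+0)-\tfrac{i}{2}\langle\psi,v_2\rangle\Big],\quad x\neq0,$$ on the domain $\{\psi\in W_2^1(\Omega):\ \psi(+0)-i\langle\psi,v_2\rangle=e^{i\alpha}[\psi(-0)+i\langle\psi,v_1\rangle]\}$. Then $A(v_1,v_2,\alpha)$ is self-adjoint in $L_2$, and for nonreal $z$ its resolvent is the integral operator with kernel $$\mathcal{G}_z(x,y;v_1,v_2,\alpha)=\mathcal{G}_z(x,y;\alpha)-\frac{1}{\gamma(z)}\sum_{j,k=1}^2\mathcal{E}_j(x,z)\gamma_{jk}(z)\overline{\mathcal{E}_k(y,\bar z)},$$ where $E_0(x,z)=\mathcal{G}_z(x,-0;\alpha)$ (limit as $y\to0^-$), $E_k(x,z)=\int\mathcal{G}_z(x,y;\alpha)v_k(y)\,dy$ ($k=1,2$), $\mathcal{E}_1=E_1+2iE_0$, $\mathcal{E}_2=E_2-2ie^{-i\alpha}E_0$, and, writing $E_j$ for $E_j(\cdot,z)$, $$\gamma_{11}(z)=2i\Big(\mathrm{sign}(\mathrm{Im}\, z)+e^{i\alpha}\langle v_2,E_0(\cdot,\bar z)\rangle-e^{-i\alpha}\langle E_0,v_2\rangle-\tfrac{i}{2}\langle E_2,v_2\rangle\Big),$$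 $$\gamma_{12}(z)=2i\Big(2e^{-i\alpha}\theta(\mathrm{Im}\, z)+\langle v_2,E_0(\cdot,\bar z)\rangle+e^{-i\alpha}\langle E_0,v_1\rangle+\tfrac{i}{2}\langle E_2,v_1\rangle\Big),$$ $$\gamma_{21}(z)=-2i\Big(2e^{i\alpha}\theta(-\mathrm{Im}\, z)+e^{i\alpha}\langle v_1,E_0(\cdot,\bar z)\rangle+\langle E_0,v_2\rangle-\tfrac{i}{2}\langle E_1,v_2\rangle\Big),$$ $$\gamma_{22}(z)=-2i\Big(-\mathrm{sign}(\mathrm{Im}\, z)+\langle v_1,E_0(\cdot,\bar z)\rangle-\langle E_0,v_1\rangle+\tfrac{i}{2}\langle E_1,v_1\rangle\Big),$$ $\gamma(z)=\gamma_{11}\gamma_{22}-\gamma_{12}\gamma_{21}$. The matrix $\Gamma(z)=\|\gamma_{jk}(z)\|$ satisfies $\Gamma^*(\bar z)=\Gamma(z)$ and $\overline{\gamma(\bar z)}=\gamma(z)\neq0$.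
   Context: $\Omega=\mathbb{R}\setminus\{0\}$; $W_2^1(\Omega)$ consists of functions whose restrictions to each half-line belong to $W_2^1$ of that half-line; $\psi(\pm0)$ are one-sided limits at $0$; $\langle f,g\rangle=\int f\bar g\,dx$. $\theta$ is the Heaviside function; $g_z(x)=i\,\mathrm{sign}(\mathrm{Im}\, z)\theta(-x\,\mathrm{Im}\, z)e^{-izx}$; $\mathcal{G}_z(x,y;\alpha)=g_z(x-y)+g_z(x)\beta(z,\alpha)\overline{g_{\bar z}(y)}$ with $\beta(z,\alpha)=i(1-e^{-i\alpha})\theta(\mathrm{Im}\, z)+i(e^{i\alpha}-1)\theta(-\mathrm{Im}\, z)$ (the resolvent kernel of $i\,d/dx$ on $\{\psi\in W_2^1(\Omega):\psi(+0)=e^{i\alpha}\psi(-0)\}$). *)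

theory Defs
  imports "HOL-Analysis.Analysis"
begin

definition L2 :: "(real \<Rightarrow> complex) \<Rightarrow> bool" where
  "L2 f \<longleftrightarrow> f \<in> borel_measurable lborel \<and> integrable lborel (\<lambda>x. (cmod (f x))\<^sup>2)"

definition inner_L2 :: "(real \<Rightarrow> complex) \<Rightarrow> (real \<Rightarrow> complex) \<Rightarrow> complex" where
  "inner_L2 f g = (LINT x|lborel. f x * cnj (g x))"

definition ae_eq :: "(real \<Rightarrow> complex) \<Rightarrow> (real \<Rightarrow> complex) \<Rightarrow> bool" where
  "ae_eq f g \<longleftrightarrow> (AE x in lborel. f x = g x)"

text \<open>psi is the (piecewise absolutely continuous) representative of an element of
  W_2^1(Omega), Omega = R minus 0, with derivative phi in L2 on each half-line.\<close>
definition W21 :: "(real \<Rightarrow> complex) \<Rightarrow> (real \<Rightarrow> complex) \<Rightarrow> bool" where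
  "W21 psi phi \<longleftrightarrow> L2 psi \<and> L2 phi \<and>
     (\<forall>a x. (0 < a \<and> 0 < x) \<or> (a < 0 \<and> x < 0) \<longrightarrow>
        psi x = psi a + (LBINT t=a..x. phi t))"

definition plus0 :: "(real \<Rightarrow> complex) \<Rightarrow> complex" where
  "plus0 psi = Lim (at_right (0::real)) psi"

definition minus0 :: "(real \<Rightarrow> complex) \<Rightarrow> complex" where
  "minus0 psi = Lim (at_left (0::real)) psi"

definition A_graph :: "(real \<Rightarrow> complex) \<Rightarrow> (real \<Rightarrow> complex) \<Rightarrow> real
     \<Rightarrow> ((real \<Rightarrow> complex) \<times> (real \<Rightarrow> complex)) set" where
  "A_graph v1 v2 \<alpha> = {(psi, chi). \<exists>phi. W21 psi phi \<and>
      plus0 psi - \<i> * inner_L2 psi v2 = exp (\<i> * \<alpha>) * (minus0 psi + \<i> * inner_L2 psi v1) \<and>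
      chi = (\<lambda>x. \<i> * phi x + v1 x * (minus0 psi + \<i>/2 * inner_L2 psi v1)
                            + v2 x * (plus0 psi - \<i>/2 * inner_L2 psi v2))}"

definition adjoint_rel :: "((real \<Rightarrow> complex) \<times> (real \<Rightarrow> complex)) set
     \<Rightarrow> ((real \<Rightarrow> complex) \<times> (real \<Rightarrow> complex)) set" where
  "adjoint_rel G = {(g, h). L2 g \<and> L2 h \<and> (\<forall>(f, k)\<in>G. inner_L2 k g = inner_L2 f h)}"

definition self_adjoint_rel :: "((real \<Rightarrow> complex) \<times> (real \<Rightarrow> complex)) set \<Rightarrow> bool" where
  "self_adjoint_rel G \<longleftrightarrow>
     (\<forall>(f, k)\<in>G. L2 f \<and> L2 k) \<and>
     (\<forall>g. L2 g \<longrightarrow> (\<forall>e>0. \<exists>(f, k)\<in>G. (LINT x|lborel. (cmod (f x - g x))\<^sup>2) < e)) \<and>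
     G \<subseteq> adjoint_rel G \<and>
     (\<forall>(g, h)\<in>adjoint_rel G. \<exists>(f, k)\<in>G. ae_eq f g \<and> ae_eq k h)"

definition heaviside :: "real \<Rightarrow> real" where
  "heaviside t = (if t > 0 then 1 else 0)"

definition gz :: "complex \<Rightarrow> real \<Rightarrow> complex" where
  "gz z x = \<i> * of_real (sgn (Im z)) * of_real (heaviside (- x * Im z)) * exp (- \<i> * z * of_real x)"

definition beta :: "complex \<Rightarrow> real \<Rightarrow> complex" where
  "beta z \<alpha> = \<i> * (1 - exp (- \<i> * \<alpha>)) * of_real (heaviside (Im z))
             + \<i> * (exp (\<i> * \<alpha>) - 1) * of_real (heaviside (- Im z))"

text \<open>Resolvent kernel of i d/dx with boundary condition psi(+0) = e^{i alpha} psi(-0).\<close>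
definition Gk :: "complex \<Rightarrow> real \<Rightarrow> real \<Rightarrow> real \<Rightarrow> complex" where
  "Gk z \<alpha> x y = gz z (x - y) + gz z x * beta z \<alpha> * cnj (gz (cnj z) y)"

definition E0 :: "complex \<Rightarrow> real \<Rightarrow> real \<Rightarrow> complex" where
  "E0 z \<alpha> x = Lim (at_left (0::real)) (\<lambda>y. Gk z \<alpha> x y)"

definition Ev :: "complex \<Rightarrow> real \<Rightarrow> (real \<Rightarrow> complex) \<Rightarrow> real \<Rightarrow> complex" where
  "Ev z \<alpha> v x = (LINT y|lborel. Gk z \<alpha> x y * v y)"

definition calE :: "(real \<Rightarrow> complex) \<Rightarrow> (real \<Rightarrow> complex) \<Rightarrow> real \<Rightarrow> nat \<Rightarrow> complex \<Rightarrow> real \<Rightarrow> complex" where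
  "calE v1 v2 \<alpha> j z x =
     (if j = 1 then Ev z \<alpha> v1 x + 2 * \<i> * E0 z \<alpha> x
      else Ev z \<alpha> v2 x - 2 * \<i> * exp (- \<i> * \<alpha>) * E0 z \<alpha> x)"

definition gam :: "(real \<Rightarrow> complex) \<Rightarrow> (real \<Rightarrow> complex) \<Rightarrow> real \<Rightarrow> nat \<Rightarrow> nat \<Rightarrow> complex \<Rightarrow> complex" where
  "gam v1 v2 \<alpha> j k z =
    (let E0z = E0 z \<alpha>; E0zb = E0 (cnj z) \<alpha>; E1 = Ev z \<alpha> v1; E2 = Ev z \<alpha> v2;
         s = of_real (sgn (Im z)) in
     if j = 1 \<and> k = 1 then
       2 * \<i> * (s + exp (\<i> * \<alpha>) * inner_L2 v2 E0zb - exp (- \<i> * \<alpha>) * inner_L2 E0z v2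
                 - \<i>/2 * inner_L2 E2 v2)
     else if j = 1 \<and> k = 2 then
       2 * \<i> * (2 * exp (- \<i> * \<alpha>) * of_real (heaviside (Im z)) + inner_L2 v2 E0zb
                 + exp (- \<i> * \<alpha>) * inner_L2 E0z v1 + \<i>/2 * inner_L2 E2 v1)
     else if j = 2 \<and> k = 1 then
       - 2 * \<i> * (2 * exp (\<i> * \<alpha>) * of_real (heaviside (- Im z))
                   + exp (\<i> * \<alpha>) * inner_L2 v1 E0zb + inner_L2 E0z v2 - \<i>/2 * inner_L2 E1 v2)
     else
       - 2 * \<i> * (- s + inner_L2 v1 E0zb - inner_L2 E0z v1 + \<i>/2 * inner_L2 E1 v1))"

definition gamma_det :: "(real \<Rightarrow> complex) \<Rightarrow> (real \<Rightarrow> complex) \<Rightarrow> real \<Rightarrow> complex \<Rightarrow> complex" where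
  "gamma_det v1 v2 \<alpha> z = gam v1 v2 \<alpha> 1 1 z * gam v1 v2 \<alpha> 2 2 z - gam v1 v2 \<alpha> 1 2 z * gam v1 v2 \<alpha> 2 1 z"

definition Gk_pert :: "(real \<Rightarrow> complex) \<Rightarrow> (real \<Rightarrow> complex) \<Rightarrow> real \<Rightarrow> complex \<Rightarrow> real \<Rightarrow> real \<Rightarrow> complex" where
  "Gk_pert v1 v2 \<alpha> z x y = Gk z \<alpha> x y
     - (1 / gamma_det v1 v2 \<alpha> z) *
       (\<Sum>j\<in>{1,2}. \<Sum>k\<in>{1,2}. calE v1 v2 \<alpha> j z x * gam v1 v2 \<alpha> j k z * cnj (calE v1 v2 \<alpha> k (cnj z) y))"

end

theory Submission
  imports Defs
begin

text \<open>Green's formula on the two half-lines, applied to the boundary condition, shows that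
  \<open>A = A(v1, v2, \<alpha>)\<close> is symmetric. For nonreal \<open>z\<close> let \<open>G\<close> be the resolvent of the unperturbed operator
  (\<open>v1 = v2 = 0\<close>). The ansatz \<open>\<psi> = G f - c\<^sub>1 \<E>\<^sub>1 - c\<^sub>2 \<E>\<^sub>2\<close> solves \<open>(A - z) \<psi> = f\<close> as soon as \<open>c\<^sub>1\<close> and \<open>c\<^sub>2\<close>
  are the coefficients \<open>avg1 v1 \<psi>\<close> and \<open>avg2 v2 \<psi>\<close> with which \<open>v1\<close> and \<open>v2\<close> enter \<open>A \<psi>\<close>; the boundary condition
  then holds automatically. This is a linear system \<open>(1 + M) c = d\<close> whose adjugate matrix is, up to the constant
  diagonal factor \<open>diag(2\<i>, -2\<i>)\<close>, the matrix \<open>\<Gamma>(z)\<close>, and \<open>\<gamma>(z) = 4 det (1 + M)\<close>. A kernel vector of \<open>1 + M\<close>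
  would give an eigenfunction of the symmetric operator \<open>A\<close> with the nonreal eigenvalue \<open>z\<close>, so \<open>\<gamma>(z) \<noteq> 0\<close>.
  Surjectivity of \<open>A - z\<close> at \<open>z = \<plusminus>\<i>\<close> and density of the domain give self-adjointness.\<close>

section \<open>Square-integrable functions and integration by parts\<close>

text \<open>The boundary condition comes for free because of the constants in \<open>calE\<close>.
  \<open>E0\<close> misses the unperturbed condition:
  \<open>plus0 - exp (\<i> * \<alpha>) * minus0\<close> equals
  \<open>- \<i> * exp (\<i> * \<alpha>)\<close> on it. The factors \<open>2 * \<i>\<close> and
  \<open>- 2 * \<i> * exp (- \<i> * \<alpha>)\<close> turn this defect into
  \<open>2 * exp (\<i> * \<alpha>)\<close> and \<open>-2\<close>, and for these values the
  requirement that the coefficients equal the averages is the perturbed condition itself. The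
  obstacle is that one-sided limits are not continuous on L2. Green's formula gives access to them:
  it writes the limit of \<open>G f\<close> at -0 as an inner product with \<open>E0\<close> at the
  conjugate point, and so makes boundary data out of every entry of \<Gamma>. The formula uses no
  pointwise derivatives; elements of \<open>W21\<close> enter only as primitives, and their products
  are handled by Fubini. The reflection x -> -x, which sends (z, \<alpha>) to (-z, -\<alpha>),
  carries results from one half-line to the other and from one half-plane to the other.\<close>

lemma borel_measurable_cnj [measurable (raw)]:
  "f \<in> borel_measurable M \<Longrightarrow> (\<lambda>x. cnj (f x)) \<in> borel_measurable M"
  by (rule borel_measurable_continuous_on[where f = cnj]) (auto intro: continuous_intros)

lemma L2_measurable: "L2 f \<Longrightarrow> f \<in> borel_measurable borel"
  by (simp add: L2_def)

lemma L2_square_integrable: "L2 f \<Longrightarrow> integrable lborel (\<lambda>x. (cmod (f x))\<^sup>2)"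
  by (simp add: L2_def)

lemma L2_dominated:
  assumes "integrable lborel (g :: real \<Rightarrow> real)" "f \<in> borel_measurable borel"
    "\<And>x. (cmod (f x))\<^sup>2 \<le> g x"
  shows "L2 f"
  unfolding L2_def
proof
  show "integrable lborel (\<lambda>x. (cmod (f x))\<^sup>2)"
    by (rule Bochner_Integration.integrable_bound[OF assms(1)])
      (use assms(2) in \<open>auto intro: order_trans[OF assms(3) abs_ge_self]\<close>)
qed (use assms(2) in simp)

lemma L2_zero: "L2 (\<lambda>x. 0)"
  by (simp add: L2_def)

lemma L2_cmult:
  assumes "L2 f"
  shows "L2 (\<lambda>x. c * f x)"
  using assms unfolding L2_def by (auto simp: norm_mult power_mult_distrib)

lemma norm_add_square_le: "(cmod (a + b))\<^sup>2 \<le> 2 * (cmod a)\<^sup>2 + 2 * (cmod b)\<^sup>2"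
proof -
  have "(cmod (a + b))\<^sup>2 \<le> (cmod a + cmod b)\<^sup>2"
    by (intro power_mono norm_triangle_ineq) auto
  also have "\<dots> \<le> 2 * (cmod a)\<^sup>2 + 2 * (cmod b)\<^sup>2"
    using sum_squares_bound[of "cmod a" "cmod b"] by (simp add: power2_sum)
  finally show ?thesis .
qed

lemma L2_add:
  assumes "L2 f" "L2 g"
  shows "L2 (\<lambda>x. f x + g x)"
proof (rule L2_dominated)
  show "integrable lborel (\<lambda>x. 2 * (cmod (f x))\<^sup>2 + 2 * (cmod (g x))\<^sup>2)"
    using assms by (auto simp: L2_def)
qed (use assms norm_add_square_le in \<open>auto simp: L2_def\<close>)

lemma L2_uminus: "L2 f \<Longrightarrow> L2 (\<lambda>x. - f x)"
  using L2_cmult[of f "-1"] by simp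

lemma L2_diff: "L2 f \<Longrightarrow> L2 g \<Longrightarrow> L2 (\<lambda>x. f x - g x)"
  using L2_add[OF _ L2_uminus, of f g] by simp

lemma L2_cnj: "L2 f \<Longrightarrow> L2 (\<lambda>x. cnj (f x))"
  by (auto simp: L2_def)

lemma L2_diff_arg:
  assumes "L2 f"
  shows "L2 (\<lambda>y. f (x - y))"
proof -
  have "integrable lborel (\<lambda>y. (cmod (f (x + (-1) * y)))\<^sup>2)"
    using assms by (intro lborel_integrable_real_affine) (auto simp: L2_def)
  thus ?thesis using assms by (auto simp: L2_def)
qed

lemma L2_reflect: "L2 f \<Longrightarrow> L2 (\<lambda>x. f (- x))"
  using L2_diff_arg[of f 0] by simp

lemma integrable_L2_mult:
  assumes "L2 f" "L2 g"
  shows "integrable lborel (\<lambda>x. f x * g x)"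
proof (rule Bochner_Integration.integrable_bound)
  show "integrable lborel (\<lambda>x. (cmod (f x))\<^sup>2 + (cmod (g x))\<^sup>2)"
    using assms by (auto simp: L2_def)
  show "AE x in lborel. norm (f x * g x) \<le> norm ((cmod (f x))\<^sup>2 + (cmod (g x))\<^sup>2)"
  proof (rule AE_I2)
    fix x
    have "2 * cmod (f x) * cmod (g x) \<le> (cmod (f x))\<^sup>2 + (cmod (g x))\<^sup>2"
      by (rule sum_squares_bound)
    moreover have "0 \<le> cmod (f x) * cmod (g x)" by simp
    ultimately have "cmod (f x) * cmod (g x) \<le> (cmod (f x))\<^sup>2 + (cmod (g x))\<^sup>2"
      by linarith
    thus "norm (f x * g x) \<le> norm ((cmod (f x))\<^sup>2 + (cmod (g x))\<^sup>2)"
      by (simp add: norm_mult)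
  qed
qed (use assms in \<open>auto simp: L2_def\<close>)

lemma integrable_inner:
  "L2 f \<Longrightarrow> L2 g \<Longrightarrow> integrable lborel (\<lambda>x. f x * cnj (g x))"
  by (intro integrable_L2_mult L2_cnj)

lemma inner_add_left:
  "L2 f \<Longrightarrow> L2 g \<Longrightarrow> L2 h \<Longrightarrow> inner_L2 (\<lambda>x. f x + g x) h = inner_L2 f h + inner_L2 g h"
  unfolding inner_L2_def by (simp add: ring_distribs integrable_inner)

lemma inner_diff_left:
  "L2 f \<Longrightarrow> L2 g \<Longrightarrow> L2 h \<Longrightarrow> inner_L2 (\<lambda>x. f x - g x) h = inner_L2 f h - inner_L2 g h"
  unfolding inner_L2_def by (simp add: ring_distribs integrable_inner)

lemma inner_cmult_left: "inner_L2 (\<lambda>x. c * f x) h = c * inner_L2 f h"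
  unfolding inner_L2_def by (simp add: mult.assoc)

lemma cnj_inner: "cnj (inner_L2 f g) = inner_L2 g f"
  unfolding inner_L2_def
  by (subst Bochner_Integration.integral_cnj[symmetric]) (simp add: mult.commute)

lemma inner_add_right:
  "L2 f \<Longrightarrow> L2 g \<Longrightarrow> L2 h \<Longrightarrow> inner_L2 h (\<lambda>x. f x + g x) = inner_L2 h f + inner_L2 h g"
  by (simp add: inner_add_left flip: cnj_inner[of _ h])

lemma inner_diff_right:
  "L2 f \<Longrightarrow> L2 g \<Longrightarrow> L2 h \<Longrightarrow> inner_L2 h (\<lambda>x. f x - g x) = inner_L2 h f - inner_L2 h g"
  by (simp add: inner_diff_left flip: cnj_inner[of _ h])

lemma inner_cmult_right: "inner_L2 h (\<lambda>x. c * f x) = cnj c * inner_L2 h f"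
  by (simp add: inner_cmult_left flip: cnj_inner[of _ h])

lemma inner_cong_AE:
  assumes "ae_eq f f'" "f \<in> borel_measurable borel" "f' \<in> borel_measurable borel"
    "h \<in> borel_measurable borel"
  shows "inner_L2 f h = inner_L2 f' h"
  unfolding inner_L2_def
  by (rule integral_cong_AE) (use assms in \<open>auto simp: ae_eq_def\<close>)

lemma ae_eq_zero_if_inner_self_zero:
  assumes "L2 f" "inner_L2 f f = 0"
  shows "ae_eq f (\<lambda>x. 0)"
proof -
  have "inner_L2 f f = (LINT x|lborel. complex_of_real ((cmod (f x))\<^sup>2))"
    unfolding inner_L2_def by (simp add: complex_norm_square del: of_real_power)
  also have "\<dots> = complex_of_real (LINT x|lborel. (cmod (f x))\<^sup>2)"
    by (rule integral_complex_of_real)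
  finally have "(LINT x|lborel. (cmod (f x))\<^sup>2) = 0" using assms(2) by simp
  hence "AE x in lborel. (cmod (f x))\<^sup>2 = 0"
    using integral_nonneg_eq_0_iff_AE[OF L2_square_integrable[OF assms(1)]] by simp
  thus ?thesis by (simp add: ae_eq_def)
qed

section \<open>Local integrability and the product rule for primitives\<close>

lemma integrable_indicator_Icc: "integrable lborel (indicator {a..b} :: real \<Rightarrow> real)"
  by (intro integrable_real_indicator) (auto intro: emeasure_lborel_Icc_eq[THEN ord_eq_less_trans])

lemma L2_set_integrable:
  assumes "L2 f"
  shows "set_integrable lborel {a..b} f"
proof -
  have "L2 (\<lambda>x. indicator {a..b} x)"
    unfolding L2_def
  proof
    have "integrable lborel (\<lambda>x. indicator {a..b} x :: real)" by (rule integrable_indicator_Icc)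
    moreover have "(\<lambda>x. (cmod (indicator {a..b} x))\<^sup>2) = (\<lambda>x. indicator {a..b} x :: real)"
      by (auto split: split_indicator)
    ultimately show "integrable lborel (\<lambda>x. (cmod (indicator {a..b} x))\<^sup>2)" by simp
  qed auto
  from integrable_L2_mult[OF this assms] show ?thesis
    unfolding set_integrable_def by (simp add: scaleR_conv_of_real of_real_indicator)
qed

text \<open>Fubini's theorem splits the square at its diagonal, which is a null set.\<close>
lemma Fubini_by_parts:
  fixes f h :: "real \<Rightarrow> complex"
  assumes f: "integrable lborel f" and h: "integrable lborel h"
  defines "F \<equiv> \<lambda>x. LINT t|lborel. indicator {..x} t * f t"
    and "H \<equiv> \<lambda>x. LINT t|lborel. indicator {..x} t * h t"
  shows "integrable lborel (\<lambda>s. f s * H s)" "integrable lborel (\<lambda>t. F t * h t)"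
    "(LINT s|lborel. f s * H s) + (LINT t|lborel. F t * h t)
      = (LINT s|lborel. f s) * (LINT t|lborel. h t)"
proof -
  have [measurable]: "f \<in> borel_measurable borel" "h \<in> borel_measurable borel"
    using f h by auto
  define P where "P = (\<lambda>(s, t). f s * h t)"
  have P: "integrable (lborel \<Otimes>\<^sub>M lborel) P"
  proof (rule lborel_pair.Fubini_integrable)
    show "P \<in> borel_measurable (lborel \<Otimes>\<^sub>M lborel)" unfolding P_def by measurable
    show "integrable lborel (\<lambda>x. LINT y|lborel. norm (P (x, y)))"
      unfolding P_def using f h by (simp add: norm_mult)
    show "AE x in lborel. integrable lborel (\<lambda>y. P (x, y))"
      unfolding P_def using f h by simp
  qed
  define Q where "Q = (\<lambda>(s, t). indicator {(s::real, t). t \<le> s} (s, t) * (f s * h t))"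
  define R where "R = (\<lambda>(s, t). indicator {(s::real, t). s < t} (s, t) * (f s * h t))"
  have [measurable]: "{(s::real, t). t \<le> s} \<in> sets (borel \<Otimes>\<^sub>M borel)"
    "{(s::real, t). s < t} \<in> sets (borel \<Otimes>\<^sub>M borel)"
    unfolding borel_prod case_prod_beta
    by (intro borel_closed borel_open closed_Collect_le open_Collect_less continuous_intros)+
  have Q: "integrable (lborel \<Otimes>\<^sub>M lborel) Q"
    by (rule Bochner_Integration.integrable_bound[OF P])
      (auto simp: Q_def P_def norm_mult split: split_indicator)
  have R: "integrable (lborel \<Otimes>\<^sub>M lborel) R"
    by (rule Bochner_Integration.integrable_bound[OF P])
      (auto simp: R_def P_def norm_mult split: split_indicator)
  have sum: "P = (\<lambda>x. Q x + R x)"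
    by (rule ext) (auto simp: P_def Q_def R_def split: split_indicator)
  have Qi: "(LINT t|lborel. Q (s, t)) = f s * H s" for s
  proof -
    have "(LINT t|lborel. Q (s, t)) = (LINT t|lborel. f s * (indicator {..s} t * h t))"
      by (intro Bochner_Integration.integral_cong) (auto simp: Q_def split: split_indicator)
    also have "\<dots> = f s * H s" unfolding H_def by (rule integral_mult_right_zero)
    finally show ?thesis .
  qed
  have Ri: "(LINT s|lborel. R (s, t)) = F t * h t" for t
  proof -
    have "(LINT s|lborel. R (s, t)) = (LINT s|lborel. (indicator {..t} s * f s) * h t)"
    proof (rule integral_cong_AE)
      have "AE s in lborel. s \<noteq> t" by (rule AE_lborel_singleton)
      thus "AE s in lborel. R (s, t) = indicator {..t} s * f s * h t"
        by eventually_elim (auto simp: R_def split: split_indicator)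
      show "(\<lambda>s. R (s, t)) \<in> borel_measurable lborel"
        unfolding R_def by simp
    qed simp
    also have "\<dots> = F t * h t" unfolding F_def by (rule integral_mult_left_zero)
    finally show ?thesis .
  qed
  show "integrable lborel (\<lambda>s. f s * H s)"
    using lborel_pair.integrable_fst'[OF Q] by (simp add: Qi)
  show "integrable lborel (\<lambda>t. F t * h t)"
    using lborel_pair.integrable_snd[of "\<lambda>x y. R (x, y)"] R by (simp add: Ri)
  have "(LINT s|lborel. f s) * (LINT t|lborel. h t) = (LINT s|lborel. LINT t|lborel. P (s, t))"
    by (simp add: P_def)
  also have "\<dots> = integral\<^sup>L (lborel \<Otimes>\<^sub>M lborel) P" by (rule lborel_pair.integral_fst'[OF P])
  also have "\<dots> = integral\<^sup>L (lborel \<Otimes>\<^sub>M lborel) Q + integral\<^sup>L (lborel \<Otimes>\<^sub>M lborel) R"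
    unfolding sum by (rule Bochner_Integration.integral_add[OF Q R])
  also have "integral\<^sup>L (lborel \<Otimes>\<^sub>M lborel) Q = (LINT s|lborel. LINT t|lborel. Q (s, t))"
    by (rule lborel_pair.integral_fst'[OF Q, symmetric])
  also have "integral\<^sup>L (lborel \<Otimes>\<^sub>M lborel) R = (LINT t|lborel. LINT s|lborel. R (s, t))"
    using lborel_pair.integral_snd[of "\<lambda>x y. R (x, y)"] R by simp
  finally show "(LINT s|lborel. f s * H s) + (LINT t|lborel. F t * h t)
      = (LINT s|lborel. f s) * (LINT t|lborel. h t)" by (simp add: Qi Ri)
qed

text \<open>The Leibniz rule for absolutely continuous functions in integrated form. The
  representations are required only on the half-open interval, so \<open>F0\<close> and
  \<open>H0\<close> may be limits at \<open>a\<close> rather than values; this allows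
  \<open>a\<close> to be the singular point 0.\<close>

lemma AC_mult:
  fixes f h F H :: "real \<Rightarrow> complex"
  assumes "a < b"
    and f: "set_integrable lborel {a..b} f" and h: "set_integrable lborel {a..b} h"
    and F: "\<And>x. a < x \<Longrightarrow> x \<le> b \<Longrightarrow> F x = F0 + (LBINT t=a..x. f t)"
    and H: "\<And>x. a < x \<Longrightarrow> x \<le> b \<Longrightarrow> H x = H0 + (LBINT t=a..x. h t)"
  shows "set_integrable lborel {a<..b} (\<lambda>t. f t * H t + F t * h t)"
    "F b * H b = F0 * H0 + (LBINT t=a..b. f t * H t + F t * h t)"
proof -
  define f1 where "f1 = (\<lambda>t. indicator {a<..b} t * f t)"
  define h1 where "h1 = (\<lambda>t. indicator {a<..b} t * h t)"
  have set1: "indicator {a<..b} t *\<^sub>R (g t :: complex) = indicator {a<..b} t * g t" for t g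
    by (simp split: split_indicator)
  have f1: "integrable lborel f1"
    using set_integrable_subset[OF f, of "{a<..b}"] unfolding set_integrable_def f1_def set1 by force
  have h1: "integrable lborel h1"
    using set_integrable_subset[OF h, of "{a<..b}"] unfolding set_integrable_def h1_def set1 by force
  have cut: "(LBINT t=a..x. g t) = (LINT t|lborel. indicator {..x} t * (indicator {a<..b} t * g t))"
    if "a < x" "x \<le> b" for x and g :: "real \<Rightarrow> complex"
  proof -
    have "(LBINT t=a..x. g t) = (LINT t|lborel. indicator {a<..x} t *\<^sub>R g t)"
      using that by (simp add: interval_integral_Ioc set_lebesgue_integral_def)
    also have "\<dots> = (LINT t|lborel. indicator {..x} t * (indicator {a<..b} t * g t))"
      using that by (intro Bochner_Integration.integral_cong) (auto split: split_indicator)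
    finally show ?thesis .
  qed
  define F1 where "F1 x = (LINT t|lborel. indicator {..x} t * f1 t)" for x
  define H1 where "H1 x = (LINT t|lborel. indicator {..x} t * h1 t)" for x
  have F1: "F x = F0 + F1 x" if "a < x" "x \<le> b" for x
    using F[OF that] cut[OF that, of f] by (simp add: F1_def f1_def)
  have H1: "H x = H0 + H1 x" if "a < x" "x \<le> b" for x
    using H[OF that] cut[OF that, of h] by (simp add: H1_def h1_def)
  note parts = Fubini_by_parts[OF f1 h1, folded F1_def H1_def]
  \<comment> \<open>Splitting off the constants from \<open>F\<close> and \<open>H\<close> leaves
    the products \<open>f1 * H1\<close> and \<open>F1 * h1\<close>, whose integrals add up to
    \<open>F1 b * H1 b\<close> by \<open>Fubini_by_parts\<close>.\<close>
  have eq: "indicator {a<..b} t *\<^sub>R (f t * H t + F t * h t)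
      = (f1 t * H0 + f1 t * H1 t) + (F0 * h1 t + F1 t * h1 t)" for t
    using F1[of t] H1[of t] by (auto simp: f1_def h1_def algebra_simps split: split_indicator)
  show "set_integrable lborel {a<..b} (\<lambda>t. f t * H t + F t * h t)"
    unfolding set_integrable_def eq using parts(1,2) f1 h1 by auto
  have F1b: "F1 b = (LINT t|lborel. f1 t)" unfolding F1_def
    by (intro Bochner_Integration.integral_cong) (auto simp: f1_def split: split_indicator)
  have H1b: "H1 b = (LINT t|lborel. h1 t)" unfolding H1_def
    by (intro Bochner_Integration.integral_cong) (auto simp: h1_def split: split_indicator)
  have "(LBINT t=a..b. f t * H t + F t * h t)
      = (LINT t|lborel. (f1 t * H0 + f1 t * H1 t) + (F0 * h1 t + F1 t * h1 t))"
    using \<open>a < b\<close> by (simp add: interval_integral_Ioc set_lebesgue_integral_def eq)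
  also have "\<dots> = F1 b * H0 + F0 * H1 b + F1 b * H1 b"
    using parts f1 h1 by (simp add: F1b H1b algebra_simps)
  finally show "F b * H b = F0 * H0 + (LBINT t=a..b. f t * H t + F t * h t)"
    using F1[of b] H1[of b] \<open>a < b\<close> by (simp add: algebra_simps)
qed

section \<open>One-sided limits and Green's formula\<close>

lemma L2_interval_integrable:
  "L2 f \<Longrightarrow> interval_lebesgue_integrable lborel (ereal a) (ereal b) f"
  unfolding interval_lebesgue_integrable_def
  using L2_set_integrable[of f a b] L2_set_integrable[of f b a]
  by (auto intro: set_integrable_subset)

lemma interval_integral_L2_split:
  "L2 f \<Longrightarrow> (LBINT t=ereal a..ereal b. f t) + (LBINT t=ereal b..ereal c. f t) = (LBINT t=ereal a..ereal c. f t)"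
  by (rule interval_integral_sum)
    (auto simp: min_def max_def intro: L2_interval_integrable)

lemma interval_integral_cnj: "(LBINT t=a..b. cnj (f t)) = cnj (LBINT t=a..b. f t)"
proof -
  have *: "indicator A t *\<^sub>R cnj z = cnj (indicator A t *\<^sub>R z)" for A :: "real set" and t z
    by simp
  show ?thesis unfolding interval_lebesgue_integral_def set_lebesgue_integral_def
    by (cases "a \<le> b")
      (simp_all only: * Bochner_Integration.integral_cnj complex_cnj_minus if_True if_False)
qed

lemma continuous_on_primitive:
  fixes f F :: "real \<Rightarrow> complex"
  assumes "set_integrable lborel {a..b} f"
    and "\<And>x. a \<le> x \<Longrightarrow> x \<le> b \<Longrightarrow> F x = c + (LBINT t=a..x. f t)"
  shows "continuous_on {a..b} F"
proof -
  have "continuous_on {a..b} (\<lambda>x. c + integral {a..x} f)"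
    using set_borel_integral_eq_integral(1)[OF assms(1)]
    by (intro continuous_intros indefinite_integral_continuous_1)
  moreover have "c + integral {a..x} f = F x" if "x \<in> {a..b}" for x
  proof -
    have "set_integrable lborel {a..x} f"
      by (rule set_integrable_subset[OF assms(1)]) (use that in auto)
    thus ?thesis
      using that by (simp add: assms(2) interval_integral_Icc set_borel_integral_eq_integral(2))
  qed
  ultimately show ?thesis by (metis (no_types, lifting) continuous_on_cong)
qed

text \<open>\<open>F\<close> is unconstrained at \<open>a\<close> itself; its continuous extension
  \<open>G\<close> takes the value \<open>F0\<close> there.\<close>

lemma tendsto_primitive_right:
  fixes f F :: "real \<Rightarrow> complex"
  assumes "a < b" "set_integrable lborel {a..b} f"
    and F: "\<And>x. a < x \<Longrightarrow> x \<le> b \<Longrightarrow> F x = F0 + (LBINT t=a..x. f t)"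
  shows "(F \<longlongrightarrow> F0) (at_right a)"
proof -
  define G where "G x = F0 + (LBINT t=a..x. f t)" for x
  have "continuous_on {a..b} G"
    by (rule continuous_on_primitive[OF assms(2)]) (simp add: G_def)
  hence "(G \<longlongrightarrow> G a) (at_right a)"
    using \<open>a < b\<close> by (metis at_within_Icc_at_right atLeastAtMost_iff continuous_on_def less_imp_le order_refl)
  moreover have "eventually (\<lambda>x. G x = F x) (at_right a)"
    using eventually_at_right_real[OF \<open>a < b\<close>] by eventually_elim (simp add: F G_def)
  ultimately show ?thesis by (simp add: G_def tendsto_cong)
qed

section \<open>The space \<open>W21\<close>: limits at 0, reflection, linear structure\<close>

lemma W21_L2: "W21 \<psi> \<phi> \<Longrightarrow> L2 \<psi>" "W21 \<psi> \<phi> \<Longrightarrow> L2 \<phi>"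
  by (simp_all add: W21_def)

lemma W21I:
  assumes "L2 \<psi>" "L2 \<phi>"
    and "\<And>a x. (0 < a \<and> 0 < x) \<or> (a < 0 \<and> x < 0) \<Longrightarrow> \<psi> x = \<psi> a + (LBINT t=ereal a..ereal x. \<phi> t)"
  shows "W21 \<psi> \<phi>"
  unfolding W21_def using assms by metis

lemma W21_eq:
  "W21 \<psi> \<phi> \<Longrightarrow> (0 < a \<and> 0 < x) \<or> (a < 0 \<and> x < 0)
    \<Longrightarrow> \<psi> x = \<psi> a + (LBINT t=ereal a..ereal x. \<phi> t)"
  unfolding W21_def by metis

text \<open>The derivative is square-integrable, hence integrable up to 0, so the base point of the
  primitive can be moved from 1 to 0. The constant obtained in this way is the one-sided
  limit.\<close>

lemma W21_plus0:
  assumes "W21 \<psi> \<phi>"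
  shows "(\<psi> \<longlongrightarrow> plus0 \<psi>) (at_right 0)"
    "\<And>x. 0 < x \<Longrightarrow> \<psi> x = plus0 \<psi> + (LBINT t=ereal 0..x. \<phi> t)"
proof -
  define p where "p = \<psi> 1 - (LBINT t=ereal 0..ereal 1. \<phi> t)"
  have eq: "\<psi> x = p + (LBINT t=ereal 0..x. \<phi> t)" if "0 < x" for x
  proof -
    have "\<psi> x = \<psi> 1 + (LBINT t=ereal 1..ereal x. \<phi> t)"
      using that by (intro W21_eq[OF assms]) auto
    thus ?thesis using interval_integral_L2_split[OF W21_L2(2)[OF assms], of 0 1 x]
      by (simp add: p_def algebra_simps)
  qed
  have lim: "(\<psi> \<longlongrightarrow> p) (at_right 0)"
    by (rule tendsto_primitive_right[of 0 1 \<phi>])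
      (auto intro: L2_set_integrable W21_L2[OF assms] eq)
  hence "plus0 \<psi> = p" unfolding plus0_def by (intro tendsto_Lim) auto
  thus "(\<psi> \<longlongrightarrow> plus0 \<psi>) (at_right 0)"
    "\<And>x. 0 < x \<Longrightarrow> \<psi> x = plus0 \<psi> + (LBINT t=ereal 0..x. \<phi> t)"
    using lim eq by auto
qed

text \<open>Reflection swaps the half-lines and flips the sign of the derivative. It reduces
  statements about the limit at -0 to those about the limit at +0.\<close>

lemma W21_reflect:
  assumes "W21 \<psi> \<phi>"
  shows "W21 (\<lambda>x. \<psi> (- x)) (\<lambda>x. - \<phi> (- x))"
  unfolding W21_def
proof (intro conjI allI impI)
  show "L2 (\<lambda>x. \<psi> (- x))" "L2 (\<lambda>x. - \<phi> (- x))"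
    using W21_L2[OF assms] by (auto intro: L2_reflect L2_uminus)
next
  fix a x :: real assume "0 < a \<and> 0 < x \<or> a < 0 \<and> x < 0"
  hence "\<psi> (- x) = \<psi> (- a) + (LBINT t=-a..-x. \<phi> t)"
    by (intro W21_eq[OF assms]) auto
  also have "(LBINT t=-a..-x. \<phi> t) = (LBINT t=ereal x..ereal a. \<phi> (- t))"
    by (subst interval_integral_reflect) simp
  also have "\<dots> = (LBINT t=ereal a..ereal x. - \<phi> (- t))"
    by (subst interval_integral_endpoints_reverse) (simp add: interval_lebesgue_integral_uminus)
  finally show "\<psi> (- x) = \<psi> (- a) + (LBINT t=ereal a..ereal x. - \<phi> (- t))" .
qed

text \<open>Valid even where no limit exists: both sides are the same definite description, since
  the two filters are images of each other under negation.\<close>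

lemma plus0_reflect: "plus0 (\<lambda>x. \<psi> (- x)) = minus0 \<psi>"
  unfolding plus0_def minus0_def Topological_Spaces.Lim_def by (simp add: at_left_minus filterlim_filtermap)

lemma minus0_reflect: "minus0 (\<lambda>x. \<psi> (- x)) = plus0 \<psi>"
  using plus0_reflect[of "\<lambda>x. \<psi> (- x)"] by simp

lemma W21_minus0:
  assumes "W21 \<psi> \<phi>"
  shows "(\<psi> \<longlongrightarrow> minus0 \<psi>) (at_left 0)"
  using W21_plus0(1)[OF W21_reflect[OF assms]]
  by (simp add: plus0_reflect at_left_minus filterlim_filtermap)

lemma plus0_eqI: "(\<psi> \<longlongrightarrow> p) (at_right 0) \<Longrightarrow> plus0 \<psi> = p"
  unfolding plus0_def by (intro tendsto_Lim) auto

lemma minus0_eqI: "(\<psi> \<longlongrightarrow> p) (at_left 0) \<Longrightarrow> minus0 \<psi> = p"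
  unfolding minus0_def by (intro tendsto_Lim) auto

lemma W21_add:
  assumes "W21 \<psi> \<phi>" "W21 \<xi> \<rho>"
  shows "W21 (\<lambda>x. \<psi> x + \<xi> x) (\<lambda>x. \<phi> x + \<rho> x)"
    "plus0 (\<lambda>x. \<psi> x + \<xi> x) = plus0 \<psi> + plus0 \<xi>"
    "minus0 (\<lambda>x. \<psi> x + \<xi> x) = minus0 \<psi> + minus0 \<xi>"
proof -
  note L = W21_L2[OF assms(1)] W21_L2[OF assms(2)]
  show "W21 (\<lambda>x. \<psi> x + \<xi> x) (\<lambda>x. \<phi> x + \<rho> x)"
  proof (rule W21I)
    fix a x :: real assume ax: "0 < a \<and> 0 < x \<or> a < 0 \<and> x < 0"
    have "(LBINT t=ereal a..ereal x. \<phi> t + \<rho> t)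
        = (LBINT t=ereal a..ereal x. \<phi> t) + (LBINT t=ereal a..ereal x. \<rho> t)"
      by (intro interval_lebesgue_integral_add L2_interval_integrable L)
    thus "\<psi> x + \<xi> x = \<psi> a + \<xi> a + (LBINT t=ereal a..ereal x. \<phi> t + \<rho> t)"
      using W21_eq[OF assms(1) ax] W21_eq[OF assms(2) ax] by simp
  qed (intro L2_add L)+
  show "plus0 (\<lambda>x. \<psi> x + \<xi> x) = plus0 \<psi> + plus0 \<xi>"
    by (intro plus0_eqI tendsto_add W21_plus0(1)[OF assms(1)] W21_plus0(1)[OF assms(2)])
  show "minus0 (\<lambda>x. \<psi> x + \<xi> x) = minus0 \<psi> + minus0 \<xi>"
    by (intro minus0_eqI tendsto_add W21_minus0[OF assms(1)] W21_minus0[OF assms(2)])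
qed

lemma W21_cmult:
  assumes "W21 \<psi> \<phi>"
  shows "W21 (\<lambda>x. c * \<psi> x) (\<lambda>x. c * \<phi> x)"
    "plus0 (\<lambda>x. c * \<psi> x) = c * plus0 \<psi>"
    "minus0 (\<lambda>x. c * \<psi> x) = c * minus0 \<psi>"
proof -
  show "W21 (\<lambda>x. c * \<psi> x) (\<lambda>x. c * \<phi> x)"
  proof (rule W21I)
    fix a x :: real assume ax: "0 < a \<and> 0 < x \<or> a < 0 \<and> x < 0"
    show "c * \<psi> x = c * \<psi> a + (LBINT t=ereal a..ereal x. c * \<phi> t)"
      by (subst W21_eq[OF assms ax]) (simp add: ring_distribs)
  qed (intro L2_cmult W21_L2[OF assms])+
  show "plus0 (\<lambda>x. c * \<psi> x) = c * plus0 \<psi>"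
    by (intro plus0_eqI tendsto_mult_left W21_plus0(1)[OF assms(1)])
  show "minus0 (\<lambda>x. c * \<psi> x) = c * minus0 \<psi>"
    by (intro minus0_eqI tendsto_mult_left W21_minus0[OF assms(1)])
qed

lemma W21_cnj:
  assumes "W21 \<psi> \<phi>"
  shows "W21 (\<lambda>x. cnj (\<psi> x)) (\<lambda>x. cnj (\<phi> x))"
    "plus0 (\<lambda>x. cnj (\<psi> x)) = cnj (plus0 \<psi>)"
proof -
  show "W21 (\<lambda>x. cnj (\<psi> x)) (\<lambda>x. cnj (\<phi> x))"
  proof (rule W21I)
    fix a x :: real assume ax: "0 < a \<and> 0 < x \<or> a < 0 \<and> x < 0"
    show "cnj (\<psi> x) = cnj (\<psi> a) + (LBINT t=ereal a..ereal x. cnj (\<phi> t))"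
      by (subst W21_eq[OF assms ax]) (simp add: interval_integral_cnj)
  qed (intro L2_cnj W21_L2[OF assms])+
  show "plus0 (\<lambda>x. cnj (\<psi> x)) = cnj (plus0 \<psi>)"
    by (intro plus0_eqI tendsto_cnj W21_plus0(1)[OF assms(1)])
qed

section \<open>Vanishing at infinity and Green's formula\<close>

text \<open>With a nonzero limit, \<open>cmod p\<close> would stay above half of
  \<open>cmod L\<close> on a ray, and a ray has infinite measure.\<close>

lemma set_integrable_tendsto_imp_zero:
  fixes p :: "real \<Rightarrow> complex"
  assumes "set_integrable lborel {a..} p" and lim: "(p \<longlongrightarrow> L) at_top"
  shows "L = 0"
proof (rule ccontr)
  assume "L \<noteq> 0"
  have "eventually (\<lambda>x. dist (p x) L < cmod L / 2) at_top"
    using lim \<open>L \<noteq> 0\<close> by (intro tendstoD) auto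
  hence "eventually (\<lambda>x. cmod L / 2 \<le> cmod (p x)) at_top"
  proof eventually_elim
    case (elim x)
    have "cmod L \<le> cmod (p x) + cmod (L - p x)"
      by (metis add.commute norm_triangle_sub)
    with elim show ?case by (simp add: dist_norm norm_minus_commute)
  qed
  then obtain c0 where c0: "\<And>x. c0 \<le> x \<Longrightarrow> cmod L / 2 \<le> cmod (p x)"
    by (auto simp: eventually_at_top_linorder)
  define c where "c = max a c0"
  have "integrable lborel (\<lambda>x. (cmod L / 2) * indicator {c..} x)"
  proof (rule Bochner_Integration.integrable_bound)
    show "integrable lborel (\<lambda>x. indicator {a..} x *\<^sub>R p x)"
      using assms(1) by (simp add: set_integrable_def)
    show "AE x in lborel. norm (cmod L / 2 * indicator {c..} x) \<le> norm (indicator {a..} x *\<^sub>R p x)"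
      using c0 by (auto simp: c_def split: split_indicator)
  qed auto
  from integrable_mult_right[OF this, of "2 / cmod L"]
  have "integrable lborel (\<lambda>x. 2 / cmod L * (cmod L / 2 * indicator {c..} x))" .
  moreover have "(\<lambda>x. 2 / cmod L * (cmod L / 2 * indicator {c..} x)) = (indicator {c..} :: real \<Rightarrow> real)"
    using \<open>L \<noteq> 0\<close> by (intro ext) (simp split: split_indicator)
  ultimately have "integrable lborel (indicator {c..} :: real \<Rightarrow> real)" by simp
  hence fin: "emeasure lborel {c..} < \<infinity>"
    by (subst (asm) integrable_indicator_iff) auto
  then obtain r where r: "0 \<le> r" "emeasure lborel {c..} = ennreal r"
    by (cases "emeasure lborel {c..}") auto
  have "real n \<le> r" for n
    using emeasure_mono[of "{c..c + real n}" "{c..}" lborel] r by simp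
  thus False using reals_Archimedean2[of r] by (meson not_less)
qed

text \<open>Integrability of \<open>q\<close> yields a limit of \<open>p\<close> at infinity, and
  integrability of \<open>p\<close> forces it to be 0. Hence no decay has to be assumed, and only
  the boundary term at 0 survives.\<close>

lemma integral_derivative_half_line:
  fixes p q :: "real \<Rightarrow> complex"
  assumes p: "set_integrable lborel {0..} p" and q: "set_integrable lborel {0..} q"
    and eq: "\<And>x. 0 < x \<Longrightarrow> p x = p0 + (LBINT t=ereal 0..x. q t)"
  shows "(LINT t:{0..}|lborel. q t) = - p0"
proof -
  have "((\<lambda>b. p0 + (LINT t:{0..b}|lborel. q t)) \<longlongrightarrow> p0 + (LINT t:{0..}|lborel. q t)) at_top"
    by (intro tendsto_intros tendsto_set_lebesgue_integral_at_top) (use q in auto)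
  moreover have "eventually (\<lambda>b. p0 + (LINT t:{0..b}|lborel. q t) = p b) at_top"
    using eventually_gt_at_top[of 0]
    by eventually_elim (simp add: eq interval_integral_Icc)
  ultimately have "(p \<longlongrightarrow> p0 + (LINT t:{0..}|lborel. q t)) at_top"
    by (simp add: tendsto_cong)
  from set_integrable_tendsto_imp_zero[OF p this] show ?thesis
    by (simp add: add_eq_0_iff)
qed

lemma Green_right:
  assumes "W21 \<psi> \<phi>" "W21 \<xi> \<rho>"
  shows "(LINT t:{0..}|lborel. \<phi> t * cnj (\<xi> t) + \<psi> t * cnj (\<rho> t)) = - plus0 \<psi> * cnj (plus0 \<xi>)"
proof -
  note L = W21_L2[OF assms(1)] W21_L2[OF assms(2)]
  note c = W21_cnj[OF assms(2)]
  have "(LINT t:{0..}|lborel. \<phi> t * cnj (\<xi> t) + \<psi> t * cnj (\<rho> t)) = - (plus0 \<psi> * cnj (plus0 \<xi>))"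
  proof (rule integral_derivative_half_line)
    have *: "integrable lborel f \<Longrightarrow> set_integrable lborel {0..} f" for f :: "real \<Rightarrow> complex"
      unfolding set_integrable_def by (rule integrable_mult_indicator) auto
    show "set_integrable lborel {0..} (\<lambda>t. \<psi> t * cnj (\<xi> t))"
      by (intro * integrable_inner L)
    show "set_integrable lborel {0..} (\<lambda>t. \<phi> t * cnj (\<xi> t) + \<psi> t * cnj (\<rho> t))"
      by (intro * Bochner_Integration.integrable_add integrable_inner L)
    fix x :: real assume "0 < x"
    show "\<psi> x * cnj (\<xi> x) = plus0 \<psi> * cnj (plus0 \<xi>)
        + (LBINT t=ereal 0..ereal x. \<phi> t * cnj (\<xi> t) + \<psi> t * cnj (\<rho> t))"
      by (rule AC_mult[OF \<open>0 < x\<close>, where H = "\<lambda>x. cnj (\<xi> x)"])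
        (use W21_plus0(2)[OF assms(1)] W21_plus0(2)[OF c(1)] in
          \<open>auto intro!: L2_set_integrable L L2_cnj simp: c(2)\<close>)
  qed
  thus ?thesis by simp
qed

theorem Green:
  assumes "W21 \<psi> \<phi>" "W21 \<xi> \<rho>"
  shows "inner_L2 \<phi> \<xi> + inner_L2 \<psi> \<rho>
    = minus0 \<psi> * cnj (minus0 \<xi>) - plus0 \<psi> * cnj (plus0 \<xi>)"
proof -
  note L = W21_L2[OF assms(1)] W21_L2[OF assms(2)]
  define q where "q t = \<phi> t * cnj (\<xi> t) + \<psi> t * cnj (\<rho> t)" for t
  have q: "integrable lborel q"
    unfolding q_def by (intro Bochner_Integration.integrable_add integrable_inner L)
  have *: "set_integrable lborel A q" if "A \<in> sets borel" for A
    unfolding set_integrable_def using that q by (intro integrable_mult_indicator) auto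
  have r: "(LINT t:{0..}|lborel. q t) = - plus0 \<psi> * cnj (plus0 \<xi>)"
    unfolding q_def by (rule Green_right[OF assms])
  \<comment> \<open>Both derivatives change sign under reflection, so the integrand of the
    right-hand formula becomes \<open>- q (- t)\<close>.\<close>
  have "(LINT t:{0..}|lborel. - q (- t)) = - minus0 \<psi> * cnj (minus0 \<xi>)"
    using Green_right[OF W21_reflect[OF assms(1)] W21_reflect[OF assms(2)]]
    by (simp add: q_def plus0_reflect)
  hence "(LINT t:{0..}|lborel. q (- t)) = minus0 \<psi> * cnj (minus0 \<xi>)"
    by (simp add: set_lebesgue_integral_def)
  moreover have "(LINT t:{..0}|lborel. q t) = (LINT t:{0..}|lborel. q (- t))"
    by (subst set_integral_reflect) (simp add: atLeast_def)
  moreover have "(LINT t|lborel. q t) = (LINT t:{..0}|lborel. q t) + (LINT t:{0..}|lborel. q t)"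
  proof -
    have "(LINT t|lborel. q t) = (LINT t|lborel. indicator {..0} t *\<^sub>R q t + indicator {0..} t *\<^sub>R q t)"
    proof (rule integral_cong_AE)
      have "AE t in lborel. t \<noteq> (0::real)" by (rule AE_lborel_singleton)
      thus "AE t in lborel. q t = indicator {..0} t *\<^sub>R q t + indicator {0..} t *\<^sub>R q t"
        by eventually_elim (auto split: split_indicator)
    qed (use q in auto)
    also have "\<dots> = (LINT t:{..0}|lborel. q t) + (LINT t:{0..}|lborel. q t)"
      using *[of "{..0}"] *[of "{0..}"] unfolding set_lebesgue_integral_def set_integrable_def
      by simp
    finally show ?thesis .
  qed
  moreover have "(LINT t|lborel. q t) = inner_L2 \<phi> \<xi> + inner_L2 \<psi> \<rho>"
    unfolding q_def inner_L2_def by (intro Bochner_Integration.integral_add integrable_inner L)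
  ultimately show ?thesis using r by simp
qed

section \<open>The unperturbed resolvent\<close>

lemma L2_cong_except_0:
  assumes "L2 f" "\<And>x. x \<noteq> 0 \<Longrightarrow> g x = f x"
  shows "L2 g"
proof -
  have g: "g = (\<lambda>x. if x = 0 then g 0 else f x)"
    using assms(2) by auto
  have [measurable]: "f \<in> borel_measurable borel"
    using assms(1) by (rule L2_measurable)
  have m: "g \<in> borel_measurable borel"
    by (subst g) measurable
  have "integrable lborel (\<lambda>x. (cmod (f x))\<^sup>2) \<longleftrightarrow> integrable lborel (\<lambda>x. (cmod (g x))\<^sup>2)"
  proof (rule integrable_cong_AE)
    have "AE x in lborel. x \<noteq> (0::real)" by (rule AE_lborel_singleton)
    thus "AE x in lborel. (cmod (f x))\<^sup>2 = (cmod (g x))\<^sup>2"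
      by eventually_elim (simp add: assms(2))
  qed (use m in auto)
  with assms(1) m show ?thesis by (simp add: L2_def)
qed

lemma W21_cong_except_0:
  assumes "W21 \<psi> \<phi>" "\<And>x. x \<noteq> 0 \<Longrightarrow> \<psi>' x = \<psi> x" "\<And>x. x \<noteq> 0 \<Longrightarrow> \<phi>' x = \<phi> x"
  shows "W21 \<psi>' \<phi>'"
proof (rule W21I)
  show "L2 \<psi>'" "L2 \<phi>'"
    using W21_L2[OF assms(1)] assms(2,3) by (auto intro: L2_cong_except_0)
  fix a x :: real assume ax: "0 < a \<and> 0 < x \<or> a < 0 \<and> x < 0"
  have "(LBINT t=ereal a..ereal x. \<phi>' t) = (LBINT t=ereal a..ereal x. \<phi> t)"
    by (rule interval_integral_cong) (use ax in \<open>auto simp: min_def max_def einterval_iff assms(3) split: if_splits\<close>)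
  thus "\<psi>' x = \<psi>' a + (LBINT t=ereal a..ereal x. \<phi>' t)"
    using W21_eq[OF assms(1) ax] ax assms(2) by auto
qed

text \<open>One-sided neighbourhoods of 0 omit 0. This matters for \<open>E0\<close>, which is
  compared with a multiple of \<open>gz\<close> only away from 0.\<close>

lemma plus0_cong_except_0:
  "(\<And>x. x \<noteq> 0 \<Longrightarrow> \<psi>' x = \<psi> x) \<Longrightarrow> plus0 \<psi>' = plus0 \<psi>"
  unfolding plus0_def Topological_Spaces.Lim_def
  by (intro arg_cong[where f = The] ext filterlim_cong refl)
    (auto simp: eventually_at intro!: exI[of _ 1])

lemma minus0_cong_except_0:
  "(\<And>x. x \<noteq> 0 \<Longrightarrow> \<psi>' x = \<psi> x) \<Longrightarrow> minus0 \<psi>' = minus0 \<psi>"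
  using plus0_cong_except_0[of "\<lambda>x. \<psi>' (- x)" "\<lambda>x. \<psi> (- x)"] by (simp add: plus0_reflect)

section \<open>The exponential kernel \<open>gz\<close> and the boundary function
  \<open>E0\<close>\<close>

lemma gz_reflect: "gz z (- x) = - gz (- z) x"
  by (simp add: gz_def sgn_if)

lemma gz_neg: "Im z < 0 \<Longrightarrow> gz z x = (if x > 0 then - \<i> * exp (- \<i> * z * x) else 0)"
  by (auto simp: gz_def heaviside_def zero_less_mult_iff mult_less_0_iff sgn_if)

lemma gz_pos: "Im z > 0 \<Longrightarrow> gz z x = (if x < 0 then \<i> * exp (- \<i> * z * x) else 0)"
  by (auto simp: gz_def heaviside_def zero_less_mult_iff mult_less_0_iff sgn_if)

lemma gz_measurable [measurable]: "gz z \<in> borel_measurable borel"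
  unfolding gz_def heaviside_def by measurable

lemma gz_L2:
  assumes "Im z \<noteq> 0"
  shows "L2 (gz z)"
proof -
  have neg: "L2 (gz z)" if "Im z < 0" for z
  proof -
    \<comment> \<open>The squared modulus of \<open>gz z\<close> is
      \<open>exp (2 * Im z * x)\<close> on the positive axis and 0 elsewhere.\<close>
    define c where "c = 2 * Im z"
    have c: "c < 0" using that by (simp add: c_def)
    have "(\<integral>\<^sup>+x. ennreal (exp (c * x)) * indicator {0..} x \<partial>lborel) = 0 - exp (c * 0) / c"
    proof (rule nn_integral_FTC_atLeast)
      have "filterlim (\<lambda>x. c * x) at_bot at_top"
        using c by (intro filterlim_tendsto_neg_mult_at_bot[OF tendsto_const] filterlim_ident)
      hence "((\<lambda>x. exp (c * x)) \<longlongrightarrow> 0) at_top"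
        by (rule filterlim_compose[OF exp_at_bot])
      thus "((\<lambda>x. exp (c * x) / c) \<longlongrightarrow> 0) at_top"
        using tendsto_divide[OF _ tendsto_const, of _ 0 at_top c] c by auto
      show "((\<lambda>x. exp (c * x) / c) has_real_derivative exp (c * x)) (at x)" for x
        using c by (auto intro!: derivative_eq_intros)
    qed auto
    hence fin: "(\<integral>\<^sup>+x. ennreal (exp (c * x)) * indicator {0..} x \<partial>lborel) < \<infinity>"
      by (metis ennreal_less_top infinity_ennreal_def)
    have "(\<lambda>x. ennreal (exp (c * x)) * indicator {0..} x)
        = (\<lambda>x. ennreal (norm (indicator {0..} x * exp (c * x))))"
      by (auto split: split_indicator)
    with fin have "integrable lborel (\<lambda>x. indicator {0..} x * exp (c * x))"
      by (intro integrableI_bounded) auto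
    thus ?thesis
    proof (rule L2_dominated)
      fix x
      have "(exp (Im z * x))\<^sup>2 = exp (c * x)"
        by (simp add: c_def power2_eq_square flip: exp_add)
      thus "(cmod (gz z x))\<^sup>2 \<le> indicator {0..} x * exp (c * x)"
        unfolding gz_neg[OF that] by (simp add: norm_mult norm_exp split: split_indicator)
    qed simp
  qed
  show ?thesis
  proof (cases "Im z < 0")
    case False
    hence "L2 (gz (- z))" using assms by (intro neg) auto
    hence "L2 (\<lambda>x. - gz (- z) (- x))" by (intro L2_uminus L2_reflect)
    thus ?thesis by (simp add: gz_reflect)
  qed (rule neg)
qed

lemma exp_primitive:
  fixes w :: complex
  shows "exp (w * of_real x) = exp (w * of_real a) + (LBINT t=ereal a..ereal x. w * exp (w * of_real t))"
proof -
  have "(LBINT t=ereal a..ereal x. w * exp (w * of_real t)) = exp (w * of_real x) - exp (w * of_real a)"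
  proof (rule interval_integral_FTC_finite)
    show "continuous_on {min a x..max a x} (\<lambda>t. w * exp (w * complex_of_real t))"
      by (intro continuous_intros)
    show "((\<lambda>t. exp (w * complex_of_real t)) has_vector_derivative w * exp (w * complex_of_real y))
        (at y within {min a x..max a x})" for y
    proof -
      have "((\<lambda>z. exp (w * z)) has_field_derivative w * exp (w * complex_of_real y)) (at (of_real y))"
        by (auto intro!: derivative_eq_intros)
      from has_field_derivative_subset[OF this, of UNIV]
      have "((\<lambda>z. exp (w * z)) has_field_derivative w * exp (w * complex_of_real y)) (at (of_real y))" by simp
      thus ?thesis
        by (intro has_vector_derivative_real_field)
    qed
  qed
  thus ?thesis by simp
qed

text \<open>On each half-line \<open>gz z\<close> solves i u' = z u. In both half-planes the jump
  \<open>plus0 - minus0\<close> is -i, which makes \<open>gz\<close> the fundamental solution of i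
  d/dx - z.\<close>

lemma W21_gz:
  assumes "Im z \<noteq> 0"
  shows "W21 (gz z) (\<lambda>x. - \<i> * z * gz z x)"
    "minus0 (gz z) = (if Im z > 0 then \<i> else 0)"
    "plus0 (gz z) = (if Im z < 0 then - \<i> else 0)"
proof -
  define cm where "cm = (if Im z > 0 then \<i> else 0)"
  define cp where "cp = (if Im z < 0 then - \<i> else 0)"
  have m: "gz z x = cm * exp (- \<i> * z * x)" if "x < 0" for x
    using that assms by (cases "Im z < 0") (auto simp: cm_def gz_neg gz_pos)
  have p: "gz z x = cp * exp (- \<i> * z * x)" if "x > 0" for x
    using that assms by (cases "Im z < 0") (auto simp: cp_def gz_neg gz_pos)
  have half: "gz z x = gz z a + (LBINT t=ereal a..ereal x. - \<i> * z * gz z t)"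
    if c: "\<And>t. t \<in> {min a x..max a x} \<Longrightarrow> gz z t = c * exp (- \<i> * z * t)" for a x c
  proof -
    have "(LBINT t=ereal a..ereal x. - \<i> * z * gz z t)
        = (LBINT t=ereal a..ereal x. c * (- \<i> * z * exp (- \<i> * z * t)))"
      by (rule interval_integral_cong) (use c in \<open>auto simp: einterval_iff min_def max_def split: if_splits\<close>)
    also have "\<dots> = c * (LBINT t=ereal a..ereal x. - \<i> * z * exp (- \<i> * z * t))"
      by (rule interval_lebesgue_integral_mult_right)
    also have "\<dots> = c * (exp (- \<i> * z * x) - exp (- \<i> * z * a))"
      by (subst exp_primitive[of "- \<i> * z" x a]) simp
    finally show ?thesis using c[of x] c[of a] by (simp add: algebra_simps)
  qed
  show "W21 (gz z) (\<lambda>x. - \<i> * z * gz z x)"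
  proof (rule W21I)
    show "L2 (gz z)" "L2 (\<lambda>x. - \<i> * z * gz z x)"
      by (intro gz_L2 L2_cmult assms)+
    fix a x :: real assume "0 < a \<and> 0 < x \<or> a < 0 \<and> x < 0"
    thus "gz z x = gz z a + (LBINT t=ereal a..ereal x. - \<i> * z * gz z t)"
    proof
      assume "0 < a \<and> 0 < x"
      thus ?thesis by (intro half[of _ _ cp] p) auto
    next
      assume "a < 0 \<and> x < 0"
      thus ?thesis by (intro half[of _ _ cm] m) auto
    qed
  qed
  have lim: "((\<lambda>x. c * exp (- \<i> * z * complex_of_real x)) \<longlongrightarrow> c) (at 0 within S)" for c S
  proof -
    have "((\<lambda>x. c * exp (- \<i> * z * complex_of_real x)) \<longlongrightarrow> c * exp (- \<i> * z * complex_of_real 0)) (at 0 within S)"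
      by (intro tendsto_intros)
    thus ?thesis by simp
  qed
  have "minus0 (gz z) = cm"
  proof (rule minus0_eqI, rule Lim_transform_eventually[OF lim])
    show "\<forall>\<^sub>F x in at_left 0. cm * exp (- \<i> * z * complex_of_real x) = gz z x"
      using eventually_at_left_real[of "-1" 0] by (auto elim: eventually_mono simp: m)
  qed
  thus "minus0 (gz z) = (if Im z > 0 then \<i> else 0)" by (simp add: cm_def)
  have "plus0 (gz z) = cp"
  proof (rule plus0_eqI, rule Lim_transform_eventually[OF lim])
    show "\<forall>\<^sub>F x in at_right 0. cp * exp (- \<i> * z * complex_of_real x) = gz z x"
      using eventually_at_right_real[of 0 1] by (auto elim: eventually_mono simp: p)
  qed
  thus "plus0 (gz z) = (if Im z < 0 then - \<i> else 0)" by (simp add: cp_def)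
qed

text \<open>The sign of the argument is constant near x, so the Heaviside factor is too, and a
  multiple of one exponential remains.\<close>

lemma gz_isCont:
  assumes "Im z \<noteq> 0" "x \<noteq> 0"
  shows "isCont (gz z) x"
proof -
  define c where "c = gz z x * exp (\<i> * z * x)"
  have "eventually (\<lambda>t. sgn t = sgn x) (nhds x)"
  proof (cases "x > 0")
    case True
    hence "eventually (\<lambda>t. t \<in> {0<..}) (nhds x)" by (intro eventually_nhds_in_open) auto
    thus ?thesis by eventually_elim (use True in simp)
  next
    case False
    hence "eventually (\<lambda>t. t \<in> {..<0}) (nhds x)"
      using assms by (intro eventually_nhds_in_open) auto
    thus ?thesis by eventually_elim (use False assms in simp)
  qed
  hence "eventually (\<lambda>t. gz z t = c * exp (- \<i> * z * t)) (nhds x)"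
  proof eventually_elim
    case (elim t)
    hence "heaviside (- t * Im z) = heaviside (- x * Im z)"
      by (auto simp: heaviside_def sgn_if zero_less_mult_iff mult_less_0_iff split: if_splits)
    thus ?case by (simp add: c_def gz_def flip: exp_add)
  qed
  moreover have "isCont (\<lambda>t. c * exp (- \<i> * z * complex_of_real t)) x"
    by (intro continuous_intros)
  ultimately show ?thesis by (subst isCont_cong)
qed

text \<open>For Im z > 0 the factor \<open>gz (cnj z)\<close> vanishes to the left of 0, so the
  \<open>beta\<close> term drops out. For Im z < 0 it tends to i, and the \<open>beta\<close> term
  contributes \<open>exp (\<i> * \<alpha>) - 1\<close> times \<open>gz z x\<close>.\<close>

lemma E0_eq:
  assumes "Im z \<noteq> 0" "x \<noteq> 0"
  shows "E0 z \<alpha> x = (if Im z > 0 then 1 else exp (\<i> * \<alpha>)) * gz z x"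
proof -
  have "((\<lambda>y. gz z (x - y)) \<longlongrightarrow> gz z (x - 0)) (at_left 0)"
  proof (rule isCont_tendsto_compose[where g = "gz z"])
    show "isCont (gz z) (x - 0)" using assms by (simp add: gz_isCont)
    show "((\<lambda>y. x - y) \<longlongrightarrow> x - 0) (at_left 0)" by (intro tendsto_intros)
  qed
  moreover have "(gz (cnj z) \<longlongrightarrow> minus0 (gz (cnj z))) (at_left 0)"
    by (rule W21_minus0[OF W21_gz(1)]) (use assms in auto)
  ultimately have "((\<lambda>y. Gk z \<alpha> x y) \<longlongrightarrow> gz z x + gz z x * beta z \<alpha> * cnj (minus0 (gz (cnj z)))) (at_left 0)"
    unfolding Gk_def by (auto intro!: tendsto_intros)
  hence "E0 z \<alpha> x = gz z x + gz z x * beta z \<alpha> * cnj (minus0 (gz (cnj z)))"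
    unfolding E0_def by (intro tendsto_Lim) auto
  also have "\<dots> = (if Im z > 0 then 1 else exp (\<i> * \<alpha>)) * gz z x"
    using assms by (auto simp: W21_gz beta_def heaviside_def algebra_simps)
  finally show ?thesis .
qed

lemma W21_E0:
  assumes "Im z \<noteq> 0"
  shows "W21 (E0 z \<alpha>) (\<lambda>x. - \<i> * z * E0 z \<alpha> x)"
    "minus0 (E0 z \<alpha>) = (if Im z > 0 then \<i> else 0)"
    "plus0 (E0 z \<alpha>) = (if Im z < 0 then - \<i> * exp (\<i> * \<alpha>) else 0)"
proof -
  define \<epsilon> where "\<epsilon> = (if Im z > 0 then 1 else exp (\<i> * \<alpha>))"
  note E = E0_eq[OF assms, of _ \<alpha>, folded \<epsilon>_def]
  note W = W21_cmult[OF W21_gz(1)[OF assms], of \<epsilon>]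
  show "W21 (E0 z \<alpha>) (\<lambda>x. - \<i> * z * E0 z \<alpha> x)"
    by (rule W21_cong_except_0[OF W(1)]) (simp_all add: E)
  have "minus0 (E0 z \<alpha>) = minus0 (\<lambda>x. \<epsilon> * gz z x)" by (rule minus0_cong_except_0) (rule E)
  thus "minus0 (E0 z \<alpha>) = (if Im z > 0 then \<i> else 0)"
    unfolding W using assms by (simp add: W21_gz \<epsilon>_def)
  have "plus0 (E0 z \<alpha>) = plus0 (\<lambda>x. \<epsilon> * gz z x)" by (rule plus0_cong_except_0) (rule E)
  thus "plus0 (E0 z \<alpha>) = (if Im z < 0 then - \<i> * exp (\<i> * \<alpha>) else 0)"
    unfolding W using assms by (simp add: W21_gz \<epsilon>_def)
qed

lemma Gk_L2: "Im z \<noteq> 0 \<Longrightarrow> L2 (\<lambda>y. Gk z \<alpha> x y)"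
  unfolding Gk_def by (intro L2_add L2_cmult L2_cnj L2_diff_arg gz_L2) auto

text \<open>Monotone convergence. It is needed because the energy estimate for the resolvent
  controls integrals over bounded intervals only.\<close>

lemma L2_if_truncations_bounded:
  assumes [measurable]: "f \<in> borel_measurable borel"
    and int: "\<And>n. set_integrable lborel {- real n..real n} (\<lambda>x. (cmod (f x))\<^sup>2)"
    and bound: "\<And>n. (LINT x:{- real n..real n}|lborel. (cmod (f x))\<^sup>2) \<le> C"
  shows "L2 f"
proof -
  define g where "g n x = ennreal (indicator {- real n..real n} x * (cmod (f x))\<^sup>2)" for n x
  have g_le: "(\<integral>\<^sup>+x. g n x \<partial>lborel) \<le> ennreal C" for n
  proof -
    have "(\<integral>\<^sup>+x. g n x \<partial>lborel) = ennreal (LINT x:{- real n..real n}|lborel. (cmod (f x))\<^sup>2)"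
      using int[of n] unfolding g_def set_lebesgue_integral_def set_integrable_def
      by (subst nn_integral_eq_integral) auto
    also have "\<dots> \<le> ennreal C" by (rule ennreal_leI) (rule bound)
    finally show ?thesis .
  qed
  have "(SUP n. g n x) = ennreal (norm ((cmod (f x))\<^sup>2))" for x
  proof (rule antisym)
    show "(SUP n. g n x) \<le> ennreal (norm ((cmod (f x))\<^sup>2))"
      by (rule SUP_least) (auto simp: g_def intro!: ennreal_leI split: split_indicator)
    obtain n where "\<bar>x\<bar> \<le> real n" using real_arch_simple by blast
    hence "x \<in> {- real n..real n}" by auto
    hence "ennreal (norm ((cmod (f x))\<^sup>2)) = g n x" by (simp add: g_def)
    also have "\<dots> \<le> (SUP n. g n x)" by (rule SUP_upper) simp
    finally show "ennreal (norm ((cmod (f x))\<^sup>2)) \<le> (SUP n. g n x)" .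
  qed
  hence "(\<integral>\<^sup>+x. ennreal (norm ((cmod (f x))\<^sup>2)) \<partial>lborel) = (\<integral>\<^sup>+x. (SUP n. g n x) \<partial>lborel)"
    by simp
  also have "\<dots> = (SUP n. \<integral>\<^sup>+x. g n x \<partial>lborel)"
  proof (rule nn_integral_monotone_convergence_SUP)
    show "incseq g"
      unfolding incseq_def le_fun_def g_def
      by (auto intro!: ennreal_leI split: split_indicator)
    show "g n \<in> borel_measurable lborel" for n unfolding g_def by measurable
  qed
  also have "\<dots> \<le> ennreal C" by (rule SUP_least) (rule g_le)
  also have "\<dots> < \<infinity>" by simp
  finally show ?thesis
    unfolding L2_def by (auto intro!: integrableI_bounded)
qed

text \<open>The half-line solution operator of the equation \<open>\<i> u' - z u = f\<close> for \<open>z\<close> in the upper half-plane,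
  up to the factor \<open>\<i>\<close>.\<close>
definition halfline_op :: "complex \<Rightarrow> (real \<Rightarrow> complex) \<Rightarrow> real \<Rightarrow> complex" where
  "halfline_op z f x = - \<i> * (LINT y|lborel. gz z (x - y) * f y)"

section \<open>The half-line solution operator in the upper half-plane\<close>

context
  fixes z :: complex and f :: "real \<Rightarrow> complex"
  assumes z: "Im z > 0" and f: "L2 f"
begin

lemma tail_L2: "L2 (\<lambda>y. indicator {x<..} y * exp (\<i> * z * of_real y))"
proof -
  have "indicator {x<..} y * exp (\<i> * z * of_real y) = (- \<i> * exp (\<i> * z * of_real x)) * gz z (x - y)" for y
    by (auto simp: gz_pos[OF z] algebra_simps simp flip: exp_add split: split_indicator)
  moreover have "L2 (\<lambda>y. (- \<i> * exp (\<i> * z * of_real x)) * gz z (x - y))"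
    by (intro L2_cmult L2_diff_arg gz_L2) (use z in auto)
  ultimately show ?thesis by simp
qed

text \<open>The convolution kernel factorises into an exponential in x and one in y, restricted to y
  > x. \<open>tail\<close> is the y-part, which is a primitive; the product rule then applies to
  exponential times \<open>tail\<close>.\<close>

definition tail :: "real \<Rightarrow> complex" where
  "tail x = (LINT y|lborel. indicator {x<..} y * exp (\<i> * z * of_real y) * f y)"

lemma halfline_op_eq_tail: "halfline_op z f x = exp (- \<i> * z * of_real x) * tail x"
proof -
  have *: "gz z (x - y) * f y
      = \<i> * exp (- \<i> * z * of_real x) * (indicator {x<..} y * exp (\<i> * z * of_real y) * f y)" for y
    by (auto simp: gz_pos[OF z] algebra_simps simp flip: exp_add split: split_indicator)
  have "(LINT y|lborel. gz z (x - y) * f y) = \<i> * exp (- \<i> * z * of_real x) * tail x"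
    unfolding * tail_def by (rule integral_mult_right_zero)
  thus ?thesis by (simp add: halfline_op_def flip: mult.assoc)
qed

lemma tail_diff:
  assumes "a \<le> x"
  shows "tail x = tail a + (LBINT t=ereal a..ereal x. - (exp (\<i> * z * of_real t) * f t))"
proof -
  have int: "integrable lborel (\<lambda>y. indicator {x<..} y * exp (\<i> * z * of_real y) * f y)" for x
    by (rule integrable_L2_mult[OF tail_L2 f])
  have "(LBINT t=ereal a..ereal x. exp (\<i> * z * of_real t) * f t)
      = (LINT y|lborel. indicator {a<..} y * exp (\<i> * z * of_real y) * f y
          - indicator {x<..} y * exp (\<i> * z * of_real y) * f y)"
    unfolding interval_integral_Ioc[OF assms] set_lebesgue_integral_def
    by (intro Bochner_Integration.integral_cong) (use assms in \<open>auto split: split_indicator\<close>)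
  also have "\<dots> = tail a - tail x"
    unfolding tail_def by (rule Bochner_Integration.integral_diff[OF int int])
  finally show ?thesis by (simp add: interval_lebesgue_integral_uminus)
qed

lemma exp_f_set_integrable: "set_integrable lborel {a..b} (\<lambda>t. - (exp (\<i> * z * of_real t) * f t))"
proof -
  \<comment> \<open>The ray is open; starting it at \<open>a - 1\<close> makes it contain the closed
    interval from a to b.\<close>
  have "integrable lborel (\<lambda>y. indicator {a - 1<..} y * exp (\<i> * z * of_real y) * f y)"
    by (rule integrable_L2_mult[OF tail_L2 f])
  hence "integrable lborel (\<lambda>y. indicator {a..b} y *\<^sub>R - (indicator {a - 1<..} y * exp (\<i> * z * of_real y) * f y))"
    by (intro integrable_mult_indicator integrable_minus) auto
  moreover have "indicator {a..b} y *\<^sub>R - (indicator {a - 1<..} y * exp (\<i> * z * of_real y) * f y)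
      = indicator {a..b} y *\<^sub>R - (exp (\<i> * z * of_real y) * f y)" for y
    by (auto split: split_indicator)
  ultimately show ?thesis by (simp only: set_integrable_def)
qed

lemma halfline_op_AC:
  assumes "a \<le> x"
  shows "halfline_op z f x = halfline_op z f a
    + (LBINT t=ereal a..ereal x. - \<i> * z * halfline_op z f t - f t)"
proof (cases "a = x")
  case False
  hence "a < x" using assms by simp
  have "exp (- \<i> * z * of_real x) * tail x = exp (- \<i> * z * of_real a) * tail a
      + (LBINT t=ereal a..ereal x. - \<i> * z * exp (- \<i> * z * of_real t) * tail t
          + exp (- \<i> * z * of_real t) * - (exp (\<i> * z * of_real t) * f t))"
  proof (rule AC_mult(2)[OF \<open>a < x\<close>, where F = "\<lambda>t. exp (- \<i> * z * of_real t)" and H = tail])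
    show "set_integrable lborel {a..x} (\<lambda>t. - \<i> * z * exp (- \<i> * z * of_real t))"
      by (intro borel_integrable_atLeastAtMost') (intro continuous_intros)
    show "set_integrable lborel {a..x} (\<lambda>t. - (exp (\<i> * z * of_real t) * f t))"
      by (rule exp_f_set_integrable)
  qed (rule exp_primitive, rule tail_diff, simp)
  also have "(\<lambda>t. - \<i> * z * exp (- \<i> * z * of_real t) * tail t
          + exp (- \<i> * z * of_real t) * - (exp (\<i> * z * of_real t) * f t))
      = (\<lambda>t. - \<i> * z * halfline_op z f t - f t)"
    by (auto simp: halfline_op_eq_tail simp flip: exp_add mult.assoc)
  finally show ?thesis by (simp only: halfline_op_eq_tail)
qed simp

lemma continuous_on_halfline_op: "continuous_on {a..b} (halfline_op z f)"
proof -
  have "continuous_on {a..b} tail"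
    by (rule continuous_on_primitive[OF exp_f_set_integrable]) (rule tail_diff)
  hence "continuous_on {a..b} (\<lambda>x. exp (- \<i> * z * of_real x) * tail x)"
    by (intro continuous_intros)
  thus ?thesis by (simp only: halfline_op_eq_tail[symmetric])
qed

lemma isCont_halfline_op: "isCont (halfline_op z f) x"
  using continuous_on_halfline_op[of "x - 1" "x + 1"]
  by (rule continuous_on_interior) simp

lemma halfline_op_measurable [measurable]: "halfline_op z f \<in> borel_measurable borel"
  by (intro borel_measurable_continuous_onI continuous_at_imp_continuous_on ballI isCont_halfline_op)

text \<open>The pointwise bound 2st \<le> s^2 + t^2 under the integral gives two squared norms, and
  the one of the translated kernel does not depend on x. The uniform bound serves to control the
  boundary term in the energy estimate.\<close>

lemma halfline_op_bounded: "\<exists>B. \<forall>x. cmod (halfline_op z f x) \<le> B"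
proof (intro exI allI)
  fix x
  have g: "L2 (\<lambda>y. gz z (x - y))" using z by (intro L2_diff_arg gz_L2) auto
  have "cmod (halfline_op z f x) = cmod (LINT y|lborel. gz z (x - y) * f y)"
    by (simp add: halfline_op_def norm_mult)
  also have "\<dots> \<le> (LINT y|lborel. cmod (gz z (x - y) * f y))" by (rule integral_norm_bound)
  also have "\<dots> \<le> (LINT y|lborel. (cmod (gz z (x - y)))\<^sup>2 + (cmod (f y))\<^sup>2)"
  proof (rule integral_mono)
    show "integrable lborel (\<lambda>y. cmod (gz z (x - y) * f y))"
      by (intro integrable_norm integrable_L2_mult g f)
    show "integrable lborel (\<lambda>y. (cmod (gz z (x - y)))\<^sup>2 + (cmod (f y))\<^sup>2)"
      by (intro Bochner_Integration.integrable_add L2_square_integrable g f)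
    fix y
    have "2 * cmod (gz z (x - y)) * cmod (f y) \<le> (cmod (gz z (x - y)))\<^sup>2 + (cmod (f y))\<^sup>2"
      by (rule sum_squares_bound)
    moreover have "0 \<le> cmod (gz z (x - y)) * cmod (f y)" by simp
    ultimately show "cmod (gz z (x - y) * f y) \<le> (cmod (gz z (x - y)))\<^sup>2 + (cmod (f y))\<^sup>2"
      unfolding norm_mult by linarith
  qed
  also have "\<dots> = (LINT y|lborel. (cmod (gz z (x - y)))\<^sup>2) + (LINT y|lborel. (cmod (f y))\<^sup>2)"
    by (intro Bochner_Integration.integral_add L2_square_integrable g f)
  also have "(LINT y|lborel. (cmod (gz z (x - y)))\<^sup>2) = (LINT y|lborel. (cmod (gz z y))\<^sup>2)"
    using lborel_integral_real_affine[of "-1" "\<lambda>y. (cmod (gz z y))\<^sup>2" x] by simp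
  finally show "cmod (halfline_op z f x) \<le> (LINT y|lborel. (cmod (gz z y))\<^sup>2) + (LINT y|lborel. (cmod (f y))\<^sup>2)" .
qed

lemma halfline_op_set_integrable: "set_integrable lborel {a..b} (\<lambda>t. - \<i> * z * halfline_op z f t - f t)"
proof -
  have "set_integrable lborel {a..b} (halfline_op z f)"
    by (intro borel_integrable_atLeastAtMost' continuous_on_halfline_op)
  thus ?thesis using L2_set_integrable[OF f] by (intro set_integral_diff set_integrable_mult_right) auto
qed

text \<open>Energy estimate: \<open>(|u|\<^sup>2)' = 2 Im z |u|\<^sup>2 - 2 Re (f cnj u)\<close> for \<open>u = halfline_op z f\<close>, and the
  mixed term is absorbed by Young's inequality.\<close>
lemma halfline_op_L2: "L2 (halfline_op z f)"
proof -
  define u where "u = halfline_op z f"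
  define s where "s = Im z"
  have s: "s > 0" using z by (simp add: s_def)
  have [measurable]: "u \<in> borel_measurable borel" "f \<in> borel_measurable borel"
    using L2_measurable[OF f] by (auto simp: u_def)
  obtain B where B: "\<And>x. cmod (u x) \<le> B" using halfline_op_bounded by (auto simp: u_def)
  define N where "N = (LINT y|lborel. (cmod (f y))\<^sup>2)"
  have uint: "set_integrable lborel {a..b} (\<lambda>x. (cmod (u x))\<^sup>2)" for a b
    using continuous_on_halfline_op[of a b, folded u_def]
    by (intro borel_integrable_atLeastAtMost' continuous_intros)
  have fint: "set_integrable lborel {a..b} (\<lambda>x. (cmod (f x))\<^sup>2)" for a b
    unfolding set_integrable_def by (intro integrable_mult_indicator L2_square_integrable f) auto
  \<comment> \<open>The bound is independent of a and b, as the passage to the whole line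
    demands.\<close>
  have key: "(LINT x:{a..b}|lborel. (cmod (u x))\<^sup>2) \<le> (B\<^sup>2 + N / s) / s" if "a < b" for a b
  proof -
    define D where "D t = - \<i> * z * u t - f t" for t
    have u: "u x = u a + (LBINT t=ereal a..ereal x. D t)" if "a < x" for x
      unfolding u_def D_def using that by (intro halfline_op_AC) auto
    have Dint: "set_integrable lborel {a..b} D"
      unfolding D_def u_def by (rule halfline_op_set_integrable)
    have Dcint: "set_integrable lborel {a..b} (\<lambda>t. cnj (D t))"
    proof -
      have "integrable lborel (\<lambda>t. cnj (indicator {a..b} t *\<^sub>R D t))"
        using Dint unfolding set_integrable_def by (rule integrable_cnj)
      thus ?thesis unfolding set_integrable_def by simp
    qed
    have uc: "cnj (u x) = cnj (u a) + (LBINT t=ereal a..ereal x. cnj (D t))" if "a < x" for x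
      using u[OF that] by (simp add: interval_integral_cnj)
    define E where "E t = D t * cnj (u t) + u t * cnj (D t)" for t
    have Eint: "set_integrable lborel {a<..b} E"
      unfolding E_def by (rule AC_mult(1)[OF that Dint Dcint u uc])
    have "u b * cnj (u b) = u a * cnj (u a) + (LBINT t=ereal a..ereal b. E t)"
      unfolding E_def by (rule AC_mult(2)[OF that Dint Dcint u uc])
    hence "(LBINT t=ereal a..ereal b. E t) = of_real ((cmod (u b))\<^sup>2 - (cmod (u a))\<^sup>2)"
      by (simp add: complex_norm_square algebra_simps del: of_real_power)
    hence "(cmod (u b))\<^sup>2 - (cmod (u a))\<^sup>2 = Re (LINT t:{a<..b}|lborel. E t)"
      using that by (simp add: interval_integral_Ioc)
    also have "\<dots> = (LINT t:{a<..b}|lborel. Re (E t))"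
      using integral_Re[OF Eint[unfolded set_integrable_def]] unfolding set_lebesgue_integral_def by simp
    finally have "(LINT t:{a<..b}|lborel. Re (E t)) = (cmod (u b))\<^sup>2 - (cmod (u a))\<^sup>2" ..
    \<comment> \<open>Only the right endpoint needs the uniform bound \<open>B\<close>; the left one
      enters with a favourable sign.\<close>
    moreover have "(cmod (u b))\<^sup>2 \<le> B\<^sup>2" by (intro power_mono B) simp
    moreover have "0 \<le> (cmod (u a))\<^sup>2" by simp
    ultimately have en: "(LINT t:{a<..b}|lborel. Re (E t)) \<le> B\<^sup>2" by linarith
    have lower: "s * (cmod (u t))\<^sup>2 - (cmod (f t))\<^sup>2 / s \<le> Re (E t)" for t
    proof -
      have "Re (E t) = 2 * s * (cmod (u t))\<^sup>2 - 2 * Re (f t * cnj (u t))"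
        unfolding E_def D_def s_def cmod_power2 by (simp add: algebra_simps power2_eq_square)
      moreover have "2 * Re (f t * cnj (u t)) \<le> (cmod (f t))\<^sup>2 / s + s * (cmod (u t))\<^sup>2"
      proof -
        \<comment> \<open>The weight \<open>s = Im z\<close> lets the mixed term absorb exactly half
          of the coercive term \<open>2 * s * (cmod (u t))\<^sup>2\<close>.\<close>
        have "0 \<le> (cmod (f t) / sqrt s - sqrt s * cmod (u t))\<^sup>2" by simp
        also have "\<dots> = (cmod (f t))\<^sup>2 / s + s * (cmod (u t))\<^sup>2 - 2 * (cmod (f t) * cmod (u t))"
          using s by (simp add: power2_diff power_divide power_mult_distrib)
        finally have "2 * (cmod (f t) * cmod (u t)) \<le> (cmod (f t))\<^sup>2 / s + s * (cmod (u t))\<^sup>2" by simp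
        moreover have "Re (f t * cnj (u t)) \<le> cmod (f t) * cmod (u t)"
          using complex_Re_le_cmod[of "f t * cnj (u t)"] by (simp add: norm_mult)
        ultimately show ?thesis by linarith
      qed
      ultimately show ?thesis by linarith
    qed
    have sub: "set_integrable lborel {a<..b} g" if "set_integrable lborel {a..b} g" for g :: "real \<Rightarrow> real"
      by (rule set_integrable_subset[OF that]) auto
    have "s * (LINT t:{a<..b}|lborel. (cmod (u t))\<^sup>2) - (LINT t:{a<..b}|lborel. (cmod (f t))\<^sup>2) / s
        = (LINT t:{a<..b}|lborel. s * (cmod (u t))\<^sup>2 - (cmod (f t))\<^sup>2 / s)"
      using sub[OF uint] sub[OF fint] by (subst set_integral_diff) auto
    also have "\<dots> \<le> (LINT t:{a<..b}|lborel. Re (E t))"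
    proof (rule set_integral_mono)
      show "set_integrable lborel {a<..b} (\<lambda>t. s * (cmod (u t))\<^sup>2 - (cmod (f t))\<^sup>2 / s)"
        using sub[OF uint] sub[OF fint] by (intro set_integral_diff) auto
      show "set_integrable lborel {a<..b} (\<lambda>t. Re (E t))"
        using integrable_Re[OF Eint[unfolded set_integrable_def]] unfolding set_integrable_def by simp
    qed (rule lower)
    also note en
    finally have "s * (LINT t:{a<..b}|lborel. (cmod (u t))\<^sup>2) \<le> B\<^sup>2 + (LINT t:{a<..b}|lborel. (cmod (f t))\<^sup>2) / s"
      by simp
    also have "(LINT t:{a<..b}|lborel. (cmod (f t))\<^sup>2) \<le> N"
      unfolding N_def set_lebesgue_integral_def
      by (intro integral_mono L2_square_integrable f sub[OF fint, unfolded set_integrable_def])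
        (auto split: split_indicator)
    finally have "s * (LINT t:{a<..b}|lborel. (cmod (u t))\<^sup>2) \<le> B\<^sup>2 + N / s"
      using s by (simp add: divide_right_mono)
    hence "(LINT t:{a<..b}|lborel. (cmod (u t))\<^sup>2) \<le> (B\<^sup>2 + N / s) / s"
      using s by (simp add: field_simps)
    moreover have "(LINT t:{a<..b}|lborel. (cmod (u t))\<^sup>2) = (LINT t:{a..b}|lborel. (cmod (u t))\<^sup>2)"
      using that by (metis interval_integral_Icc interval_integral_Ioc less_imp_le)
    ultimately show ?thesis by simp
  qed
  have "0 \<le> N" unfolding N_def by simp
  have "L2 u"
  proof (rule L2_if_truncations_bounded[OF _ uint])
    show "(LINT x:{- real n..real n}|lborel. (cmod (u x))\<^sup>2) \<le> (B\<^sup>2 + N / s) / s" for n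
    \<comment> \<open>\<open>key\<close> is stated for a < b, so the degenerate interval is treated
      separately.\<close>
    proof (cases "n = 0")
      case True
      have "(LINT x:{0..0}|lborel. (cmod (u x))\<^sup>2) = 0"
        using interval_integral_Icc[of 0 0 "\<lambda>x. (cmod (u x))\<^sup>2"] by simp
      thus ?thesis using True s \<open>0 \<le> N\<close> by simp
    qed (auto intro: key)
  qed simp
  thus ?thesis by (simp add: u_def)
qed

lemma W21_halfline_op:
  "W21 (halfline_op z f) (\<lambda>x. - \<i> * z * halfline_op z f x - f x)"
proof (rule W21I)
  show L: "L2 (\<lambda>x. - \<i> * z * halfline_op z f x - f x)"
    by (intro L2_diff L2_cmult halfline_op_L2 f)
  show "halfline_op z f x = halfline_op z f a + (LBINT t=ereal a..ereal x. - \<i> * z * halfline_op z f t - f t)" for a x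
  proof (cases "a \<le> x")
    case False
    thus ?thesis
      by (subst interval_integral_endpoints_reverse) (use halfline_op_AC[of x a] in simp)
  qed (rule halfline_op_AC)
qed (rule halfline_op_L2)

lemma halfline_op_at_0:
  "plus0 (halfline_op z f) = halfline_op z f 0" "minus0 (halfline_op z f) = halfline_op z f 0"
  using isCont_halfline_op[of 0] unfolding isCont_def
  by (auto intro!: plus0_eqI minus0_eqI dest: filterlim_at_split[THEN iffD1])

end

section \<open>The unperturbed resolvent in both half-planes\<close>

definition Gop :: "complex \<Rightarrow> real \<Rightarrow> (real \<Rightarrow> complex) \<Rightarrow> real \<Rightarrow> complex" where
  "Gop z \<alpha> f x = (LINT y|lborel. Gk z \<alpha> x y * f y)"

text \<open>In the upper half-plane \<open>cnj (gz (cnj z) y)\<close> is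
  \<open>gz z (0 - y)\<close>. The rank-one part of the kernel therefore only samples
  \<open>halfline_op\<close> at 0.\<close>

lemma Gop_upper:
  assumes z: "Im z > 0" and f: "L2 f"
  shows "Gop z \<alpha> f x = \<i> * halfline_op z f x + beta z \<alpha> * \<i> * halfline_op z f 0 * gz z x"
proof -
  have L: "L2 (\<lambda>y. gz z (x - y))" "L2 (\<lambda>y. cnj (gz (cnj z) y))"
    using z by (auto intro!: L2_diff_arg L2_cnj gz_L2)
  have c: "cnj (gz (cnj z) y) = gz z (0 - y)" for y
    using z by (auto simp: gz_pos gz_neg exp_cnj)
  have "Gop z \<alpha> f x = (LINT y|lborel. gz z (x - y) * f y + gz z x * beta z \<alpha> * (cnj (gz (cnj z) y) * f y))"
    unfolding Gop_def Gk_def by (simp add: algebra_simps)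
  also have "\<dots> = (LINT y|lborel. gz z (x - y) * f y) + gz z x * beta z \<alpha> * (LINT y|lborel. cnj (gz (cnj z) y) * f y)"
    using integrable_L2_mult[OF L(1) f] integrable_L2_mult[OF L(2) f] by simp
  also have "\<dots> = \<i> * halfline_op z f x + beta z \<alpha> * \<i> * halfline_op z f 0 * gz z x"
  proof -
    have "(LINT y|lborel. gz z (x - y) * f y) = \<i> * halfline_op z f x"
      "(LINT y|lborel. cnj (gz (cnj z) y) * f y) = \<i> * halfline_op z f 0"
      unfolding halfline_op_def c by simp_all
    thus ?thesis by (simp only:) (simp add: mult_ac)
  qed
  finally show ?thesis .
qed

text \<open>Under x -> -x the operator i d/dx changes sign and the two limits in the boundary
  condition are exchanged, which replaces \<alpha> by -\<alpha>.\<close>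

lemma Gk_reflect: "Gk (- z) (- \<alpha>) (- x) (- y) = - Gk z \<alpha> x y"
proof -
  have "gz (- z) (- x - - y) = - gz z (x - y)"
    using gz_reflect[of "- z" "x - y"] by simp
  moreover have "beta (- z) (- \<alpha>) = - beta z \<alpha>"
    by (simp add: beta_def algebra_simps)
  ultimately show ?thesis
    using gz_reflect[of "- z" x] gz_reflect[of "- cnj z" y] by (simp add: Gk_def)
qed

lemma Gop_reflect: "Gop z \<alpha> f x = - Gop (- z) (- \<alpha>) (\<lambda>y. f (- y)) (- x)"
proof -
  have "Gop (- z) (- \<alpha>) (\<lambda>y. f (- y)) (- x) = (LINT y|lborel. Gk (- z) (- \<alpha>) (- x) (- y) * f y)"
    unfolding Gop_def
    using lborel_integral_real_affine[of "-1" "\<lambda>y. Gk (- z) (- \<alpha>) (- x) y * f (- y)" 0] by simp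
  also have "\<dots> = - Gop z \<alpha> f x"
    unfolding Gop_def Gk_reflect by simp
  finally show ?thesis by simp
qed

text \<open>For Im z > 0, \<open>halfline_op\<close> is continuous at 0 while \<open>gz\<close>
  contributes to the limit at -0 only. The value of \<open>beta\<close> is the one that turns this
  limit into \<open>exp (- \<i> * \<alpha>)\<close> times the limit at +0. The lower half-plane
  follows by reflection.\<close>

theorem W21_Gop:
  assumes "Im z \<noteq> 0" "L2 f"
  shows "W21 (Gop z \<alpha> f) (\<lambda>x. - \<i> * (f x + z * Gop z \<alpha> f x))" (is ?W)
    "plus0 (Gop z \<alpha> f) = exp (\<i> * \<alpha>) * minus0 (Gop z \<alpha> f)" (is ?B)
proof -
  have upper: "W21 (Gop z \<alpha> f) (\<lambda>x. - \<i> * (f x + z * Gop z \<alpha> f x)) \<and>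
      plus0 (Gop z \<alpha> f) = exp (\<i> * \<alpha>) * minus0 (Gop z \<alpha> f)"
    if z: "Im z > 0" and f: "L2 f" for z \<alpha> f
  proof -
    define c where "c = beta z \<alpha> * \<i> * halfline_op z f 0"
    have G: "Gop z \<alpha> f = (\<lambda>x. \<i> * halfline_op z f x + c * gz z x)"
      using Gop_upper[OF z f] by (auto simp: c_def)
    have z0: "Im z \<noteq> 0" using z by simp
    note h = W21_cmult[OF W21_halfline_op[OF z f], of \<i>]
    note g = W21_cmult[OF W21_gz(1)[OF z0], of c]
    note W = W21_add[OF h(1) g(1)]
    have b: "beta z \<alpha> = \<i> * (1 - exp (- \<i> * \<alpha>))" using z by (simp add: beta_def heaviside_def)
    have e: "exp (\<i> * complex_of_real \<alpha>) * exp (- \<i> * complex_of_real \<alpha>) = 1"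
      by (simp flip: exp_add)
    have "(\<lambda>x. \<i> * (- \<i> * z * halfline_op z f x - f x) + c * (- \<i> * z * gz z x))
        = (\<lambda>x. - \<i> * (f x + z * Gop z \<alpha> f x))"
      unfolding G by (intro ext) (simp add: algebra_simps)
    with W(1) have "W21 (Gop z \<alpha> f) (\<lambda>x. - \<i> * (f x + z * Gop z \<alpha> f x))"
      unfolding G by simp
    moreover have "plus0 (Gop z \<alpha> f) = \<i> * halfline_op z f 0"
      unfolding G W(2) h(2) g(2) using z by (simp add: halfline_op_at_0[OF z f] W21_gz)
    moreover have "minus0 (Gop z \<alpha> f) = \<i> * exp (- \<i> * \<alpha>) * halfline_op z f 0"
      unfolding G W(3) h(3) g(3) using z
      by (simp add: halfline_op_at_0[OF z f] W21_gz c_def b algebra_simps)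
    ultimately show ?thesis using e by (simp add: algebra_simps)
  qed
  have "?W \<and> ?B"
  proof (cases "Im z > 0")
    case True
    thus ?thesis using upper assms(2) by simp
  next
    case False
    define v where "v = Gop (- z) (- \<alpha>) (\<lambda>y. f (- y))"
    have v: "W21 v (\<lambda>x. - \<i> * (f (- x) + (- z) * v x))" "plus0 v = exp (\<i> * (- \<alpha>)) * minus0 v"
      using upper[of "- z" "\<lambda>y. f (- y)" "- \<alpha>"] False assms L2_reflect[OF assms(2)]
      by (auto simp: v_def)
    have G: "Gop z \<alpha> f = (\<lambda>x. - 1 * v (- x))"
    proof (rule ext)
      show "Gop z \<alpha> f x = - 1 * v (- x)" for x
        unfolding v_def by (subst Gop_reflect) simp
    qed
    note W = W21_cmult[OF W21_reflect[OF v(1)], of "- 1"]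
    have e: "exp (\<i> * complex_of_real \<alpha>) * exp (\<i> * complex_of_real (- \<alpha>)) = 1"
      by (simp flip: exp_add)
    have "(\<lambda>x. - 1 * - (- \<i> * (f (- (- x)) + (- z) * v (- x)))) = (\<lambda>x. - \<i> * (f x + z * Gop z \<alpha> f x))"
      unfolding G by (intro ext) (simp add: algebra_simps)
    with W(1) have ?W unfolding G by simp
    moreover have "plus0 (Gop z \<alpha> f) = exp (\<i> * \<alpha>) * minus0 (Gop z \<alpha> f)"
      unfolding G W(2,3) plus0_reflect minus0_reflect v(2) using e by algebra
    ultimately show ?thesis by simp
  qed
  thus ?W ?B by auto
qed

section \<open>The perturbed operator\<close>

lemma Ev_eq_Gop: "Ev z \<alpha> v = Gop z \<alpha> v"
  unfolding Ev_def Gop_def by simp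

lemma inner_first_order:
  assumes "L2 f" "L2 g" "L2 h"
  shows "inner_L2 (\<lambda>x. - \<i> * (f x + z * g x)) h = - \<i> * inner_L2 f h - \<i> * z * inner_L2 g h"
    "inner_L2 h (\<lambda>x. - \<i> * (f x + z * g x)) = \<i> * inner_L2 h f + \<i> * cnj z * inner_L2 h g"
proof -
  have 1: "inner_L2 (\<lambda>x. - \<i> * (f x + z * g x)) h = - \<i> * inner_L2 f h - \<i> * z * inner_L2 g h"
    if "L2 f" "L2 g" "L2 h" for f g h z
    using that by (simp only: inner_cmult_left inner_add_left L2_cmult) (simp add: algebra_simps)
  show "inner_L2 (\<lambda>x. - \<i> * (f x + z * g x)) h = - \<i> * inner_L2 f h - \<i> * z * inner_L2 g h"
    by (rule 1[OF assms])
  have "inner_L2 h (\<lambda>x. - \<i> * (f x + z * g x)) = cnj (inner_L2 (\<lambda>x. - \<i> * (f x + z * g x)) h)"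
    by (simp only: cnj_inner)
  also have "\<dots> = \<i> * inner_L2 h f + \<i> * cnj z * inner_L2 h g"
    unfolding 1[OF assms] by (simp add: cnj_inner)
  finally show "inner_L2 h (\<lambda>x. - \<i> * (f x + z * g x)) = \<i> * inner_L2 h f + \<i> * cnj z * inner_L2 h g" .
qed

lemma exp_cancel: "exp (\<i> * complex_of_real \<alpha>) * exp (- \<i> * complex_of_real \<alpha>) = 1"
  by (simp flip: exp_add)

lemma cnj_exp_i: "cnj (exp (\<i> * complex_of_real \<alpha>)) = exp (- \<i> * complex_of_real \<alpha>)"
  by (simp add: exp_cnj)

text \<open>Green's formula for \<open>Gop z \<alpha> f\<close> and
  \<open>E0 (cnj z) \<alpha>\<close>: the terms containing z cancel, and the boundary terms reduce
  to the limit at -0. This translates the inner products with \<open>E0\<close> at the conjugate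
  point in \<Gamma> into boundary values.\<close>

lemma inner_E0:
  assumes "Im z \<noteq> 0" "L2 f"
  shows "inner_L2 f (E0 (cnj z) \<alpha>) = minus0 (Gop z \<alpha> f)"
proof -
  note u = W21_Gop[OF assms, of \<alpha>]
  have z': "Im (cnj z) \<noteq> 0" using assms by simp
  note e = W21_E0[OF z', of \<alpha>]
  have "inner_L2 (\<lambda>x. - \<i> * (f x + z * Gop z \<alpha> f x)) (E0 (cnj z) \<alpha>)
      + inner_L2 (Gop z \<alpha> f) (\<lambda>x. - \<i> * cnj z * E0 (cnj z) \<alpha> x) = - \<i> * inner_L2 f (E0 (cnj z) \<alpha>)"
    unfolding inner_first_order(1)[OF assms(2) W21_L2(1)[OF u(1)] W21_L2(1)[OF e(1)]] inner_cmult_right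
    by simp
  hence "- \<i> * inner_L2 f (E0 (cnj z) \<alpha>) = minus0 (Gop z \<alpha> f) * cnj (minus0 (E0 (cnj z) \<alpha>))
      - exp (\<i> * \<alpha>) * minus0 (Gop z \<alpha> f) * cnj (plus0 (E0 (cnj z) \<alpha>))"
    unfolding Green[OF u(1) e(1)] u(2) by simp
  also have "\<dots> = - \<i> * minus0 (Gop z \<alpha> f)"
  proof (cases "Im z > 0")
    case True
    have "exp (\<i> * \<alpha>) * minus0 (Gop z \<alpha> f) * cnj (- \<i> * exp (\<i> * \<alpha>)) = \<i> * minus0 (Gop z \<alpha> f)"
      unfolding complex_cnj_mult cnj_exp_i using exp_cancel[of \<alpha>] by simp
    with True show ?thesis by (simp add: e)
  qed (use assms in \<open>simp add: e\<close>)
  finally show ?thesis by simp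
qed

text \<open>The adjoint of the resolvent is the resolvent at the conjugate point. Both functions
  satisfy the same condition with a unimodular factor, so the boundary terms in Green's formula
  cancel.\<close>

lemma inner_Gop:
  assumes "Im z \<noteq> 0" "L2 f" "L2 g"
  shows "inner_L2 (Gop z \<alpha> f) g = inner_L2 f (Gop (cnj z) \<alpha> g)"
proof -
  have z': "Im (cnj z) \<noteq> 0" using assms by simp
  note u = W21_Gop[OF assms(1,2), of \<alpha>] and w = W21_Gop[OF z' assms(3), of \<alpha>]
  have "inner_L2 (\<lambda>x. - \<i> * (f x + z * Gop z \<alpha> f x)) (Gop (cnj z) \<alpha> g)
      + inner_L2 (Gop z \<alpha> f) (\<lambda>x. - \<i> * (g x + cnj z * Gop (cnj z) \<alpha> g x))
      = \<i> * (inner_L2 (Gop z \<alpha> f) g - inner_L2 f (Gop (cnj z) \<alpha> g))"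
    unfolding inner_first_order(1)[OF assms(2) W21_L2(1)[OF u(1)] W21_L2(1)[OF w(1)]]
      inner_first_order(2)[OF assms(3) W21_L2(1)[OF w(1)] W21_L2(1)[OF u(1)]]
    by (simp add: algebra_simps)
  moreover have "minus0 (Gop z \<alpha> f) * cnj (minus0 (Gop (cnj z) \<alpha> g))
      - plus0 (Gop z \<alpha> f) * cnj (plus0 (Gop (cnj z) \<alpha> g)) = 0"
    unfolding u(2) w(2) complex_cnj_mult cnj_exp_i using exp_cancel[of \<alpha>] by algebra
  ultimately have "\<i> * (inner_L2 (Gop z \<alpha> f) g - inner_L2 f (Gop (cnj z) \<alpha> g)) = 0"
    using Green[OF u(1) w(1)] by simp
  thus ?thesis by simp
qed

text \<open>The coefficients of \<open>v1\<close> and \<open>v2\<close> in the action of the operator.\<close>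
definition avg1 :: "(real \<Rightarrow> complex) \<Rightarrow> (real \<Rightarrow> complex) \<Rightarrow> complex" where
  "avg1 v \<psi> = minus0 \<psi> + \<i>/2 * inner_L2 \<psi> v"

definition avg2 :: "(real \<Rightarrow> complex) \<Rightarrow> (real \<Rightarrow> complex) \<Rightarrow> complex" where
  "avg2 v \<psi> = plus0 \<psi> - \<i>/2 * inner_L2 \<psi> v"

text \<open>A nonzero limit would keep \<psi> away from 0 on a whole interval next to 0. The lemma
  bridges the gap between equality almost everywhere, which is all that a vanishing norm gives, and
  the pointwise limits in the averages.\<close>

lemma plus0_ae_zero:
  assumes "W21 \<psi> \<phi>" "ae_eq \<psi> (\<lambda>x. 0)"
  shows "plus0 \<psi> = 0"
proof (rule ccontr)
  assume "plus0 \<psi> \<noteq> 0"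
  hence "eventually (\<lambda>x. \<psi> x \<noteq> 0) (at_right 0)"
    using W21_plus0(1)[OF assms(1)] tendsto_imp_eventually_ne by blast
  then obtain d where d: "0 < d" "\<And>x. 0 < x \<Longrightarrow> x < d \<Longrightarrow> \<psi> x \<noteq> 0"
    by (auto simp: eventually_at_right_field)
  have "AE x in lborel. x \<notin> {0<..<d}"
    using assms(2) unfolding ae_eq_def by eventually_elim (use d in auto)
  hence "emeasure lborel {0<..<d} = 0"
    by (subst (asm) AE_iff_measurable[of "{0<..<d}"]) auto
  thus False using \<open>0 < d\<close> by simp
qed

lemma minus0_ae_zero:
  assumes "W21 \<psi> \<phi>" "ae_eq \<psi> (\<lambda>x. 0)"
  shows "minus0 \<psi> = 0"
proof -
  have "ae_eq (\<lambda>x. \<psi> (- x)) (\<lambda>x. 0)"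
    using assms(2) AE_borel_affine[of "-1" "\<lambda>x. \<psi> x = 0" 0] L2_measurable[OF W21_L2(1)[OF assms(1)]]
    unfolding ae_eq_def by (simp add: pred_def)
  from plus0_ae_zero[OF W21_reflect[OF assms(1)] this] show ?thesis
    by (simp add: plus0_reflect)
qed

lemma singular_2x2_kernel:
  fixes a b c d :: complex
  assumes "a * d - b * c = 0"
  obtains x y where "x \<noteq> 0 \<or> y \<noteq> 0" "a * x + b * y = 0" "c * x + d * y = 0"
proof (cases "a = 0 \<and> b = 0")
  case True
  show ?thesis
  proof (cases "c = 0 \<and> d = 0")
    case True
    with \<open>a = 0 \<and> b = 0\<close> show ?thesis by (intro that[of 1 0]) auto
  next
    case False
    with \<open>a = 0 \<and> b = 0\<close> show ?thesis by (intro that[of d "- c"]) auto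
  qed
next
  case False
  with assms show ?thesis by (intro that[of b "- a"]) (auto simp: algebra_simps)
qed

text \<open>The boundary terms of Green's formula cancel against the rank-two terms exactly when the boundary
  condition holds.\<close>
lemma boundary_form_identity:
  fixes m p p1 p2 M P P1 P2 g1 g2 :: complex
  assumes G: "g1 + g2 = m * M - p * P"
    and BC: "(p - \<i> * p2) * (P + \<i> * P2) = (m + \<i> * p1) * (M - \<i> * P1)"
  shows "\<i> * g1 + (m + \<i> / 2 * p1) * P1 + (p - \<i> / 2 * p2) * P2
    = - \<i> * g2 + (M - \<i> / 2 * P1) * p1 + (P + \<i> / 2 * P2) * p2" (is "?l = ?r")
proof -
  have "2 * (?l - ?r) = 2 * (\<i> * (g1 + g2 - (m * M - p * P))
      - \<i> * ((p - \<i> * p2) * (P + \<i> * P2) - (m + \<i> * p1) * (M - \<i> * P1)))"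
    by (simp add: algebra_simps)
  also have "\<dots> = 0" unfolding G BC by simp
  finally show ?thesis unfolding mult_eq_0_iff by simp
qed

section \<open>Symmetry of the perturbed operator\<close>

context
  fixes v1 v2 :: "real \<Rightarrow> complex" and \<alpha> :: real
  assumes v1: "L2 v1" and v2: "L2 v2"
begin

lemma A_graph_symmetric:
  assumes "(f, k) \<in> A_graph v1 v2 \<alpha>" "(f', k') \<in> A_graph v1 v2 \<alpha>"
  shows "inner_L2 k f' = inner_L2 f k'"
proof -
  obtain \<phi> where \<phi>: "W21 f \<phi>"
    "plus0 f - \<i> * inner_L2 f v2 = exp (\<i> * \<alpha>) * (minus0 f + \<i> * inner_L2 f v1)"
    "k = (\<lambda>x. \<i> * \<phi> x + v1 x * avg1 v1 f + v2 x * avg2 v2 f)"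
    using assms(1) unfolding A_graph_def avg1_def avg2_def by blast
  obtain \<phi>' where \<phi>': "W21 f' \<phi>'"
    "plus0 f' - \<i> * inner_L2 f' v2 = exp (\<i> * \<alpha>) * (minus0 f' + \<i> * inner_L2 f' v1)"
    "k' = (\<lambda>x. \<i> * \<phi>' x + v1 x * avg1 v1 f' + v2 x * avg2 v2 f')"
    using assms(2) unfolding A_graph_def avg1_def avg2_def by blast
  have lin: "inner_L2 (\<lambda>x. \<i> * \<phi> x + v1 x * c + v2 x * d) g
      = \<i> * inner_L2 \<phi> g + c * inner_L2 v1 g + d * inner_L2 v2 g" if "L2 \<phi>" "L2 g" for \<phi> g c d
    using that v1 v2 by (simp add: inner_add_left inner_cmult_left L2_cmult L2_add mult.commute[of _ c] mult.commute[of _ d])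
  have "inner_L2 k f' = \<i> * inner_L2 \<phi> f' + avg1 v1 f * cnj (inner_L2 f' v1) + avg2 v2 f * cnj (inner_L2 f' v2)"
    unfolding \<phi>(3) lin[OF W21_L2(2)[OF \<phi>(1)] W21_L2(1)[OF \<phi>'(1)]] cnj_inner ..
  moreover have "cnj (inner_L2 f k') = \<i> * inner_L2 \<phi>' f + avg1 v1 f' * cnj (inner_L2 f v1) + avg2 v2 f' * cnj (inner_L2 f v2)"
    unfolding cnj_inner unfolding \<phi>'(3) lin[OF W21_L2(2)[OF \<phi>'(1)] W21_L2(1)[OF \<phi>(1)]] ..
  hence "inner_L2 f k' = cnj (\<i> * inner_L2 \<phi>' f + avg1 v1 f' * cnj (inner_L2 f v1) + avg2 v2 f' * cnj (inner_L2 f v2))"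
    by (metis complex_cnj_cnj)
  hence "inner_L2 f k' = - \<i> * inner_L2 f \<phi>' + cnj (avg1 v1 f') * inner_L2 f v1 + cnj (avg2 v2 f') * inner_L2 f v2"
    by (simp add: cnj_inner)
  moreover have "\<i> * inner_L2 \<phi> f' + avg1 v1 f * cnj (inner_L2 f' v1) + avg2 v2 f * cnj (inner_L2 f' v2)
      = - \<i> * inner_L2 f \<phi>' + (cnj (minus0 f') - \<i> / 2 * cnj (inner_L2 f' v1)) * inner_L2 f v1
        + (cnj (plus0 f') + \<i> / 2 * cnj (inner_L2 f' v2)) * inner_L2 f v2"
    unfolding avg1_def avg2_def
  proof (rule boundary_form_identity)
    show "inner_L2 \<phi> f' + inner_L2 f \<phi>' = minus0 f * cnj (minus0 f') - plus0 f * cnj (plus0 f')"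
      by (rule Green[OF \<phi>(1) \<phi>'(1)])
    \<comment> \<open>One boundary condition times the conjugate of the other; the phase has modulus
      one and disappears.\<close>
    have "(plus0 f - \<i> * inner_L2 f v2) * cnj (plus0 f' - \<i> * inner_L2 f' v2)
        = (minus0 f + \<i> * inner_L2 f v1) * cnj (minus0 f' + \<i> * inner_L2 f' v1)"
      unfolding \<phi>(2) \<phi>'(2) complex_cnj_mult cnj_exp_i using exp_cancel[of \<alpha>] by algebra
    thus "(plus0 f - \<i> * inner_L2 f v2) * (cnj (plus0 f') + \<i> * cnj (inner_L2 f' v2))
        = (minus0 f + \<i> * inner_L2 f v1) * (cnj (minus0 f') - \<i> * cnj (inner_L2 f' v1))"
      by simp
  qed
  ultimately show ?thesis by (simp add: avg1_def avg2_def)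
qed

section \<open>The perturbed resolvent at a fixed nonreal point\<close>

context
  fixes z :: complex
  assumes z: "Im z \<noteq> 0"
begin

text \<open>\<open>E0\<close> solves the homogeneous equation off 0, so adding a multiple of it to
  \<open>Gop z \<alpha> v\<close> keeps the right-hand side v and changes the boundary values
  only.\<close>

lemma W21_calE:
  "W21 (calE v1 v2 \<alpha> 1 z) (\<lambda>x. - \<i> * (v1 x + z * calE v1 v2 \<alpha> 1 z x))"
  "minus0 (calE v1 v2 \<alpha> 1 z) = minus0 (Gop z \<alpha> v1) + 2 * \<i> * minus0 (E0 z \<alpha>)"
  "plus0 (calE v1 v2 \<alpha> 1 z) = exp (\<i> * \<alpha>) * minus0 (Gop z \<alpha> v1) + 2 * \<i> * plus0 (E0 z \<alpha>)"
  "W21 (calE v1 v2 \<alpha> 2 z) (\<lambda>x. - \<i> * (v2 x + z * calE v1 v2 \<alpha> 2 z x))"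
  "minus0 (calE v1 v2 \<alpha> 2 z) = minus0 (Gop z \<alpha> v2) + - 2 * \<i> * exp (- \<i> * \<alpha>) * minus0 (E0 z \<alpha>)"
  "plus0 (calE v1 v2 \<alpha> 2 z) = exp (\<i> * \<alpha>) * minus0 (Gop z \<alpha> v2) + - 2 * \<i> * exp (- \<i> * \<alpha>) * plus0 (E0 z \<alpha>)"
proof -
  have gen: "W21 (\<lambda>x. Gop z \<alpha> v x + c * E0 z \<alpha> x) (\<lambda>x. - \<i> * (v x + z * (Gop z \<alpha> v x + c * E0 z \<alpha> x)))"
    "minus0 (\<lambda>x. Gop z \<alpha> v x + c * E0 z \<alpha> x) = minus0 (Gop z \<alpha> v) + c * minus0 (E0 z \<alpha>)"
    "plus0 (\<lambda>x. Gop z \<alpha> v x + c * E0 z \<alpha> x) = exp (\<i> * \<alpha>) * minus0 (Gop z \<alpha> v) + c * plus0 (E0 z \<alpha>)"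
    if "L2 v" for v c
  proof -
    note u = W21_Gop[OF z that, of \<alpha>]
    note e = W21_cmult[OF W21_E0(1)[OF z, of \<alpha>], of c]
    note s = W21_add[OF u(1) e(1)]
    have "(\<lambda>x. - \<i> * (v x + z * Gop z \<alpha> v x) + c * (- \<i> * z * E0 z \<alpha> x))
        = (\<lambda>x. - \<i> * (v x + z * (Gop z \<alpha> v x + c * E0 z \<alpha> x)))"
      by (simp add: algebra_simps)
    with s(1) show "W21 (\<lambda>x. Gop z \<alpha> v x + c * E0 z \<alpha> x)
        (\<lambda>x. - \<i> * (v x + z * (Gop z \<alpha> v x + c * E0 z \<alpha> x)))" by simp
    show "minus0 (\<lambda>x. Gop z \<alpha> v x + c * E0 z \<alpha> x) = minus0 (Gop z \<alpha> v) + c * minus0 (E0 z \<alpha>)"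
      by (simp only: s e)
    show "plus0 (\<lambda>x. Gop z \<alpha> v x + c * E0 z \<alpha> x) = exp (\<i> * \<alpha>) * minus0 (Gop z \<alpha> v) + c * plus0 (E0 z \<alpha>)"
      by (simp only: s e u)
  qed
  have c1: "calE v1 v2 \<alpha> 1 z = (\<lambda>x. Gop z \<alpha> v1 x + 2 * \<i> * E0 z \<alpha> x)"
    by (rule ext) (simp add: calE_def Ev_eq_Gop)
  have c2: "calE v1 v2 \<alpha> 2 z = (\<lambda>x. Gop z \<alpha> v2 x + - 2 * \<i> * exp (- \<i> * \<alpha>) * E0 z \<alpha> x)"
    by (rule ext) (simp add: calE_def Ev_eq_Gop)
  show "W21 (calE v1 v2 \<alpha> 1 z) (\<lambda>x. - \<i> * (v1 x + z * calE v1 v2 \<alpha> 1 z x))"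
    "minus0 (calE v1 v2 \<alpha> 1 z) = minus0 (Gop z \<alpha> v1) + 2 * \<i> * minus0 (E0 z \<alpha>)"
    "plus0 (calE v1 v2 \<alpha> 1 z) = exp (\<i> * \<alpha>) * minus0 (Gop z \<alpha> v1) + 2 * \<i> * plus0 (E0 z \<alpha>)"
    unfolding c1 by (rule gen[OF v1])+
  show "W21 (calE v1 v2 \<alpha> 2 z) (\<lambda>x. - \<i> * (v2 x + z * calE v1 v2 \<alpha> 2 z x))"
    "minus0 (calE v1 v2 \<alpha> 2 z) = minus0 (Gop z \<alpha> v2) + - 2 * \<i> * exp (- \<i> * \<alpha>) * minus0 (E0 z \<alpha>)"
    "plus0 (calE v1 v2 \<alpha> 2 z) = exp (\<i> * \<alpha>) * minus0 (Gop z \<alpha> v2) + - 2 * \<i> * exp (- \<i> * \<alpha>) * plus0 (E0 z \<alpha>)"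
    unfolding c2 by (rule gen[OF v2])+
qed

lemma inner_calE:
  assumes "L2 g"
  shows "inner_L2 (calE v1 v2 \<alpha> 1 z) g = inner_L2 (Gop z \<alpha> v1) g + 2 * \<i> * inner_L2 (E0 z \<alpha>) g"
    "inner_L2 (calE v1 v2 \<alpha> 2 z) g
      = inner_L2 (Gop z \<alpha> v2) g + - 2 * \<i> * exp (- \<i> * \<alpha>) * inner_L2 (E0 z \<alpha>) g"
proof -
  have c1: "calE v1 v2 \<alpha> 1 z = (\<lambda>x. Gop z \<alpha> v1 x + 2 * \<i> * E0 z \<alpha> x)"
    by (rule ext) (simp add: calE_def Ev_eq_Gop)
  have c2: "calE v1 v2 \<alpha> 2 z = (\<lambda>x. Gop z \<alpha> v2 x + - 2 * \<i> * exp (- \<i> * \<alpha>) * E0 z \<alpha> x)"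
    by (rule ext) (simp add: calE_def Ev_eq_Gop)
  note L = W21_L2(1)[OF W21_Gop(1)[OF z v1]] W21_L2(1)[OF W21_Gop(1)[OF z v2]] W21_L2(1)[OF W21_E0(1)[OF z]]
  show "inner_L2 (calE v1 v2 \<alpha> 1 z) g = inner_L2 (Gop z \<alpha> v1) g + 2 * \<i> * inner_L2 (E0 z \<alpha>) g"
    unfolding c1 by (simp only: inner_add_left inner_cmult_left L2_cmult L assms)
  show "inner_L2 (calE v1 v2 \<alpha> 2 z) g
      = inner_L2 (Gop z \<alpha> v2) g + - 2 * \<i> * exp (- \<i> * \<alpha>) * inner_L2 (E0 z \<alpha>) g"
    unfolding c2 by (simp only: inner_add_left inner_cmult_left L2_cmult L assms)
qed

text \<open>The explicit formulas are the averages of \<open>calE\<close> written out, with limits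
  of \<open>Gop\<close> expressed through \<open>inner_E0\<close>. The sign terms arise from the
  ones on the diagonal: in the first entry \<open>1 - 2 * heaviside (- Im z)\<close> is the sign of
  Im z.\<close>

lemma gam_eq:
  "gam v1 v2 \<alpha> 1 1 z = 2 * \<i> * (1 + avg2 v2 (calE v1 v2 \<alpha> 2 z))"
  "gam v1 v2 \<alpha> 1 2 z = 2 * \<i> * avg1 v1 (calE v1 v2 \<alpha> 2 z)"
  "gam v1 v2 \<alpha> 2 1 z = - 2 * \<i> * avg2 v2 (calE v1 v2 \<alpha> 1 z)"
  "gam v1 v2 \<alpha> 2 2 z = - 2 * \<i> * (1 + avg1 v1 (calE v1 v2 \<alpha> 1 z))"
proof -
  define em where "em = exp (- \<i> * complex_of_real \<alpha>)"
  define ep where "ep = exp (\<i> * complex_of_real \<alpha>)"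
  have e: "ep * em = 1" unfolding em_def ep_def by (rule exp_cancel)
  have m: "minus0 (E0 z \<alpha>) = \<i> * of_real (heaviside (Im z))"
    using z by (simp add: W21_E0 heaviside_def)
  have p: "plus0 (E0 z \<alpha>) = - \<i> * ep * of_real (heaviside (- Im z))"
    using z by (auto simp: W21_E0 heaviside_def ep_def)
  have h: "complex_of_real (heaviside (- Im z)) = 1 - of_real (heaviside (Im z))"
    using z by (auto simp: heaviside_def)
  have s: "complex_of_real (sgn (Im z)) = 2 * of_real (heaviside (Im z)) - 1"
    using z by (auto simp: heaviside_def sgn_if)
  note rules = gam_def Let_def avg1_def avg2_def inner_calE[OF v1] inner_calE[OF v2] W21_calE
    inner_E0[OF z v1] inner_E0[OF z v2] Ev_eq_Gop m p s em_def[symmetric] ep_def[symmetric] h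
  show "gam v1 v2 \<alpha> 1 1 z = 2 * \<i> * (1 + avg2 v2 (calE v1 v2 \<alpha> 2 z))"
    unfolding rules using e by (simp add: field_simps) algebra
  show "gam v1 v2 \<alpha> 1 2 z = 2 * \<i> * avg1 v1 (calE v1 v2 \<alpha> 2 z)"
    unfolding rules using e by (simp add: field_simps)
  show "gam v1 v2 \<alpha> 2 1 z = - 2 * \<i> * avg2 v2 (calE v1 v2 \<alpha> 1 z)"
    unfolding rules using e by (simp add: field_simps)
  show "gam v1 v2 \<alpha> 2 2 z = - 2 * \<i> * (1 + avg1 v1 (calE v1 v2 \<alpha> 1 z))"
    unfolding rules using e by (simp add: field_simps)
qed

lemma combination_in_graph:
  fixes c d :: complex
  assumes f: "L2 f"
  defines "\<psi> \<equiv> \<lambda>x. Gop z \<alpha> f x + - c * calE v1 v2 \<alpha> 1 z x + - d * calE v1 v2 \<alpha> 2 z x"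
  shows "avg1 v1 \<psi> = avg1 v1 (Gop z \<alpha> f) - c * avg1 v1 (calE v1 v2 \<alpha> 1 z) - d * avg1 v1 (calE v1 v2 \<alpha> 2 z)"
    "avg2 v2 \<psi> = avg2 v2 (Gop z \<alpha> f) - c * avg2 v2 (calE v1 v2 \<alpha> 1 z) - d * avg2 v2 (calE v1 v2 \<alpha> 2 z)"
    "avg1 v1 \<psi> = c \<Longrightarrow> avg2 v2 \<psi> = d \<Longrightarrow> (\<psi>, \<lambda>x. f x + z * \<psi> x) \<in> A_graph v1 v2 \<alpha>"
    "\<exists>\<phi>. W21 \<psi> \<phi>"
proof -
  note u = W21_Gop[OF z f, of \<alpha>]
  note k1 = W21_cmult[OF W21_calE(1), of "- c"] and k2 = W21_cmult[OF W21_calE(4), of "- d"]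
  note s1 = W21_add[OF u(1) k1(1)]
  note s2 = W21_add[OF s1(1) k2(1), folded \<psi>_def]
  note L = W21_L2(1)[OF u(1)] W21_L2(1)[OF k1(1)] W21_L2(1)[OF k2(1)]
  have inner: "inner_L2 \<psi> v = inner_L2 (Gop z \<alpha> f) v - c * inner_L2 (calE v1 v2 \<alpha> 1 z) v
      - d * inner_L2 (calE v1 v2 \<alpha> 2 z) v" if "L2 v" for v
    unfolding \<psi>_def inner_add_left[OF L2_add[OF L(1,2)] L(3) that] inner_add_left[OF L(1,2) that] inner_cmult_left
    by simp
  have m: "minus0 \<psi> = minus0 (Gop z \<alpha> f) - c * minus0 (calE v1 v2 \<alpha> 1 z) - d * minus0 (calE v1 v2 \<alpha> 2 z)"
    unfolding s2(3) s1(3) k1(3) k2(3) by simp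
  have p: "plus0 \<psi> = plus0 (Gop z \<alpha> f) - c * plus0 (calE v1 v2 \<alpha> 1 z) - d * plus0 (calE v1 v2 \<alpha> 2 z)"
    unfolding s2(2) s1(2) k1(2) k2(2) by simp
  show a1: "avg1 v1 \<psi> = avg1 v1 (Gop z \<alpha> f) - c * avg1 v1 (calE v1 v2 \<alpha> 1 z) - d * avg1 v1 (calE v1 v2 \<alpha> 2 z)"
    unfolding avg1_def m inner[OF v1] by (simp add: algebra_simps)
  show a2: "avg2 v2 \<psi> = avg2 v2 (Gop z \<alpha> f) - c * avg2 v2 (calE v1 v2 \<alpha> 1 z) - d * avg2 v2 (calE v1 v2 \<alpha> 2 z)"
    unfolding avg2_def p inner[OF v2] by (simp add: algebra_simps)
  show "\<exists>\<phi>. W21 \<psi> \<phi>" using s2(1) by blast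
  assume cd: "avg1 v1 \<psi> = c" "avg2 v2 \<psi> = d"
  have E0: "plus0 (E0 z \<alpha>) - exp (\<i> * \<alpha>) * minus0 (E0 z \<alpha>) = - \<i> * exp (\<i> * \<alpha>)"
    using z by (auto simp: W21_E0)
  \<comment> \<open>\<open>algebra\<close> treats \<i> as an unknown, so its square has to be
    supplied.\<close>
  have "\<i> * \<i> = -1" by simp
  hence jump: "plus0 \<psi> - exp (\<i> * \<alpha>) * minus0 \<psi> = - 2 * exp (\<i> * \<alpha>) * c + 2 * d"
    unfolding m p W21_calE u(2) using E0 exp_cancel[of \<alpha>] by algebra
  \<comment> \<open>With the averages inserted for c and d, each limit occurs twice on the right of
    \<open>jump\<close> and once on the left; cancelling one copy leaves the boundary
    condition.\<close>
  have bc: "plus0 \<psi> - \<i> * inner_L2 \<psi> v2 = exp (\<i> * \<alpha>) * (minus0 \<psi> + \<i> * inner_L2 \<psi> v1)"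
    using jump unfolding cd[symmetric] avg1_def avg2_def by (simp add: algebra_simps)
  have "(\<lambda>x. f x + z * \<psi> x) = (\<lambda>x. \<i> * (- \<i> * (f x + z * Gop z \<alpha> f x)
      + - c * (- \<i> * (v1 x + z * calE v1 v2 \<alpha> 1 z x)) + - d * (- \<i> * (v2 x + z * calE v1 v2 \<alpha> 2 z x)))
      + v1 x * avg1 v1 \<psi> + v2 x * avg2 v2 \<psi>)"
    unfolding cd by (rule ext) (simp add: \<psi>_def algebra_simps)
  with s2(1) bc show "(\<psi>, \<lambda>x. f x + z * \<psi> x) \<in> A_graph v1 v2 \<alpha>"
    unfolding A_graph_def avg1_def avg2_def by blast
qed

text \<open>Nontriviality is read off the coefficients, not off \<psi>. The kernel equations say
  that the averages of \<psi> are \<open>c1\<close> and \<open>c2\<close>, whereas symmetry makes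
  \<psi> vanish almost everywhere and thereby both averages.\<close>

lemma gamma_det_nonzero: "gamma_det v1 v2 \<alpha> z \<noteq> 0"
proof
  define a1 where "a1 = avg1 v1 (calE v1 v2 \<alpha> 1 z)"
  define a2 where "a2 = avg1 v1 (calE v1 v2 \<alpha> 2 z)"
  define b1 where "b1 = avg2 v2 (calE v1 v2 \<alpha> 1 z)"
  define b2 where "b2 = avg2 v2 (calE v1 v2 \<alpha> 2 z)"
  assume "gamma_det v1 v2 \<alpha> z = 0"
  moreover have "\<i> * \<i> = -1" by simp
  ultimately have "4 * ((1 + a1) * (1 + b2) - a2 * b1) = 0"
    unfolding gamma_det_def gam_eq a1_def a2_def b1_def b2_def by algebra
  hence "(1 + a1) * (1 + b2) - a2 * b1 = 0" by simp
  then obtain c1 c2 where c: "c1 \<noteq> 0 \<or> c2 \<noteq> 0" "(1 + a1) * c1 + a2 * c2 = 0" "b1 * c1 + (1 + b2) * c2 = 0"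
    by (rule singular_2x2_kernel)
  define \<psi> where "\<psi> = (\<lambda>x. Gop z \<alpha> (\<lambda>y. 0) x + - c1 * calE v1 v2 \<alpha> 1 z x + - c2 * calE v1 v2 \<alpha> 2 z x)"
  note comb = combination_in_graph[OF L2_zero, where c = c1 and d = c2, folded \<psi>_def, folded a1_def a2_def b1_def b2_def]
  have zero: "Gop z \<alpha> (\<lambda>y. 0) = (\<lambda>x. 0)" by (simp add: Gop_def fun_eq_iff)
  have "plus0 (\<lambda>x. 0) = 0" "minus0 (\<lambda>x. 0) = 0" "inner_L2 (\<lambda>x. 0) v = 0" for v
    by (auto intro: plus0_eqI minus0_eqI simp: inner_L2_def)
  hence z0: "avg1 v1 (Gop z \<alpha> (\<lambda>y. 0)) = 0" "avg2 v2 (Gop z \<alpha> (\<lambda>y. 0)) = 0"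
    unfolding zero avg1_def avg2_def by auto
  have a\<psi>: "avg1 v1 \<psi> = c1" using comb(1) z0 c(2) by (simp add: algebra_simps) algebra
  have b\<psi>: "avg2 v2 \<psi> = c2" using comb(2) z0 c(3) by (simp add: algebra_simps) algebra
  have g: "(\<psi>, \<lambda>x. z * \<psi> x) \<in> A_graph v1 v2 \<alpha>" using comb(3)[OF a\<psi> b\<psi>] by (simp add: \<psi>_def)
  obtain \<phi> where \<phi>: "W21 \<psi> \<phi>" using comb(4) by blast
  have "z * inner_L2 \<psi> \<psi> = cnj z * inner_L2 \<psi> \<psi>"
    using A_graph_symmetric[OF g g] by (simp add: inner_cmult_left inner_cmult_right)
  hence "(z - cnj z) * inner_L2 \<psi> \<psi> = 0" by (simp add: algebra_simps)
  moreover have "z - cnj z \<noteq> 0" using z by (simp add: complex_eq_iff)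
  ultimately have "inner_L2 \<psi> \<psi> = 0" by simp
  hence ae: "ae_eq \<psi> (\<lambda>x. 0)" by (rule ae_eq_zero_if_inner_self_zero[OF W21_L2(1)[OF \<phi>]])
  have inner0: "inner_L2 \<psi> v = 0" if "L2 v" for v
    using inner_cong_AE[OF ae L2_measurable[OF W21_L2(1)[OF \<phi>]] _ L2_measurable[OF that]]
    by (simp add: inner_L2_def)
  have "avg1 v1 \<psi> = 0" "avg2 v2 \<psi> = 0"
    unfolding avg1_def avg2_def inner0[OF v1] inner0[OF v2]
      plus0_ae_zero[OF \<phi> ae] minus0_ae_zero[OF \<phi> ae] by simp_all
  thus False using a\<psi> b\<psi> c(1) by simp
qed

text \<open>This is why the second factor of the kernel lives at the conjugate point: pairing with
  \<open>calE\<close> there computes the averages of \<open>Gop z \<alpha> f\<close>, the right-hand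
  side of the linear system, up to the factors -2i and 2i.\<close>

lemma inner_calE_cnj:
  assumes f: "L2 f"
  shows "inner_L2 f (calE v1 v2 \<alpha> 1 (cnj z)) = - 2 * \<i> * avg1 v1 (Gop z \<alpha> f)"
    "inner_L2 f (calE v1 v2 \<alpha> 2 (cnj z)) = 2 * \<i> * avg2 v2 (Gop z \<alpha> f)"
    "L2 (calE v1 v2 \<alpha> 1 (cnj z))" "L2 (calE v1 v2 \<alpha> 2 (cnj z))"
proof -
  have z': "Im (cnj z) \<noteq> 0" using z by simp
  have c1: "calE v1 v2 \<alpha> 1 (cnj z) = (\<lambda>x. Gop (cnj z) \<alpha> v1 x + 2 * \<i> * E0 (cnj z) \<alpha> x)"
    by (rule ext) (simp add: calE_def Ev_eq_Gop)
  have c2: "calE v1 v2 \<alpha> 2 (cnj z) = (\<lambda>x. Gop (cnj z) \<alpha> v2 x + - 2 * \<i> * exp (- \<i> * \<alpha>) * E0 (cnj z) \<alpha> x)"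
    by (rule ext) (simp add: calE_def Ev_eq_Gop)
  note L = W21_L2(1)[OF W21_Gop(1)[OF z' v1]] W21_L2(1)[OF W21_Gop(1)[OF z' v2]] W21_L2(1)[OF W21_E0(1)[OF z']]
  have e: "cnj (exp (- \<i> * complex_of_real \<alpha>)) = exp (\<i> * complex_of_real \<alpha>)" by (simp add: exp_cnj)
  show "inner_L2 f (calE v1 v2 \<alpha> 1 (cnj z)) = - 2 * \<i> * avg1 v1 (Gop z \<alpha> f)"
    unfolding c1 inner_add_right[OF L(1) L2_cmult[OF L(3)] f] inner_cmult_right inner_E0[OF z f]
      inner_Gop[OF z f v1, symmetric] avg1_def by (simp add: algebra_simps)
  show "inner_L2 f (calE v1 v2 \<alpha> 2 (cnj z)) = 2 * \<i> * avg2 v2 (Gop z \<alpha> f)"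
    unfolding c2 inner_add_right[OF L(2) L2_cmult[OF L(3)] f] inner_cmult_right inner_E0[OF z f]
      inner_Gop[OF z f v2, symmetric] avg2_def W21_Gop(2)[OF z f] complex_cnj_mult e
    by (simp add: algebra_simps)
  show "L2 (calE v1 v2 \<alpha> 1 (cnj z))" "L2 (calE v1 v2 \<alpha> 2 (cnj z))"
    unfolding c1 c2 by (intro L2_add L2_cmult L)+
qed

theorem resolvent_kernel:
  assumes f: "L2 f"
  defines "\<psi> \<equiv> \<lambda>x. LINT y|lborel. Gk_pert v1 v2 \<alpha> z x y * f y"
  shows "integrable lborel (\<lambda>y. Gk_pert v1 v2 \<alpha> z x y * f y)"
    "(\<psi>, \<lambda>x. f x + z * \<psi> x) \<in> A_graph v1 v2 \<alpha>"
proof -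
  define \<gamma> where "\<gamma> = gamma_det v1 v2 \<alpha> z"
  note L = inner_calE_cnj(3,4)[OF f]
  define F1 where "F1 = inner_L2 f (calE v1 v2 \<alpha> 1 (cnj z))"
  define F2 where "F2 = inner_L2 f (calE v1 v2 \<alpha> 2 (cnj z))"
  \<comment> \<open>\<open>c1\<close> and \<open>c2\<close> collect what the kernel puts in front of
    \<open>calE\<close> 1 and 2 after integration against f.\<close>
  define c1 where "c1 = (gam v1 v2 \<alpha> 1 1 z * F1 + gam v1 v2 \<alpha> 1 2 z * F2) / \<gamma>"
  define c2 where "c2 = (gam v1 v2 \<alpha> 2 1 z * F1 + gam v1 v2 \<alpha> 2 2 z * F2) / \<gamma>"
  define k1 where "k1 x = (calE v1 v2 \<alpha> 1 z x * gam v1 v2 \<alpha> 1 1 z + calE v1 v2 \<alpha> 2 z x * gam v1 v2 \<alpha> 2 1 z) / \<gamma>" for x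
  define k2 where "k2 x = (calE v1 v2 \<alpha> 1 z x * gam v1 v2 \<alpha> 1 2 z + calE v1 v2 \<alpha> 2 z x * gam v1 v2 \<alpha> 2 2 z) / \<gamma>" for x
  have split: "Gk_pert v1 v2 \<alpha> z x y * f y = Gk z \<alpha> x y * f y
      - (k1 x * (f y * cnj (calE v1 v2 \<alpha> 1 (cnj z) y)) + k2 x * (f y * cnj (calE v1 v2 \<alpha> 2 (cnj z) y)))" for x y
    unfolding Gk_pert_def k1_def k2_def \<gamma>_def
    by (simp add: add_divide_distrib ring_distribs mult_ac)
  have i0: "integrable lborel (\<lambda>y. Gk z \<alpha> x y * f y)" for x
    by (rule integrable_L2_mult[OF Gk_L2[OF z] f])
  note i1 = integrable_inner[OF f L(1)] and i2 = integrable_inner[OF f L(2)]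
  show "integrable lborel (\<lambda>y. Gk_pert v1 v2 \<alpha> z x y * f y)"
    unfolding split using i0 i1 i2 by simp
  have \<psi>: "\<psi> = (\<lambda>x. Gop z \<alpha> f x + - c1 * calE v1 v2 \<alpha> 1 z x + - c2 * calE v1 v2 \<alpha> 2 z x)"
  proof
    fix x
    have "\<psi> x = Gop z \<alpha> f x - (k1 x * F1 + k2 x * F2)"
      unfolding \<psi>_def split Gop_def F1_def F2_def inner_L2_def using i0 i1 i2 by simp
    also have "\<dots> = Gop z \<alpha> f x + - c1 * calE v1 v2 \<alpha> 1 z x + - c2 * calE v1 v2 \<alpha> 2 z x"
      unfolding k1_def k2_def c1_def c2_def
      by (simp add: add_divide_distrib ring_distribs mult_ac)
    finally show "\<psi> x = Gop z \<alpha> f x + - c1 * calE v1 v2 \<alpha> 1 z x + - c2 * calE v1 v2 \<alpha> 2 z x" .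
  qed
  note comb = combination_in_graph[OF f, where c = c1 and d = c2, folded \<psi>]
  have \<gamma>: "\<gamma> \<noteq> 0" unfolding \<gamma>_def by (rule gamma_det_nonzero)
  define a1 where "a1 = avg1 v1 (calE v1 v2 \<alpha> 1 z)"
  define a2 where "a2 = avg1 v1 (calE v1 v2 \<alpha> 2 z)"
  define b1 where "b1 = avg2 v2 (calE v1 v2 \<alpha> 1 z)"
  define b2 where "b2 = avg2 v2 (calE v1 v2 \<alpha> 2 z)"
  define a0 where "a0 = avg1 v1 (Gop z \<alpha> f)"
  define b0 where "b0 = avg2 v2 (Gop z \<alpha> f)"
  note ab = a1_def[symmetric] a2_def[symmetric] b1_def[symmetric] b2_def[symmetric] a0_def[symmetric] b0_def[symmetric]
  have ii: "\<i> * \<i> = -1" by simp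
  have F: "F1 = - 2 * \<i> * a0" "F2 = 2 * \<i> * b0"
    unfolding F1_def F2_def inner_calE_cnj[OF f] ab by auto
  have c: "\<gamma> * c1 = 2 * \<i> * (1 + b2) * F1 + 2 * \<i> * a2 * F2"
    "\<gamma> * c2 = - 2 * \<i> * b1 * F1 + - 2 * \<i> * (1 + a1) * F2"
    using \<gamma> unfolding c1_def c2_def gam_eq ab by auto
  have \<gamma>eq: "\<gamma> = 4 * ((1 + a1) * (1 + b2) - a2 * b1)"
    unfolding \<gamma>_def gamma_det_def gam_eq ab using ii by algebra
  \<comment> \<open>Cramer's rule, multiplied by \<gamma>. The factors in \<Gamma> and in
    \<open>F1\<close>, \<open>F2\<close> combine to (2i)(-2i) = 4, the same 4 as in
    \<open>\<gamma>eq\<close>.\<close>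
  have "\<gamma> * (a0 - c1 * a1 - c2 * a2) = \<gamma> * c1" "\<gamma> * (b0 - c1 * b1 - c2 * b2) = \<gamma> * c2"
    using c \<gamma>eq F ii by algebra+
  hence "a0 - c1 * a1 - c2 * a2 = c1" "b0 - c1 * b1 - c2 * b2 = c2" using \<gamma> by auto
  hence "avg1 v1 \<psi> = c1" "avg2 v2 \<psi> = c2"
    using comb(1,2) unfolding ab by simp_all
  from comb(3)[OF this] show "(\<psi>, \<lambda>x. f x + z * \<psi> x) \<in> A_graph v1 v2 \<alpha>"
    by (simp add: \<psi>)
qed

text \<open>Conjugation exchanges \<open>E0\<close> at z with \<open>E0\<close> at the conjugate
  point, reverses the sign of the imaginary part in the Heaviside and sign terms, and by
  \<open>inner_Gop\<close> moves the resolvent to the other argument. The terms match one by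
  one.\<close>

lemma gam_cnj:
  assumes "j \<in> {1, 2}" "k \<in> {1, 2}"
  shows "cnj (gam v1 v2 \<alpha> k j (cnj z)) = gam v1 v2 \<alpha> j k z"
proof -
  have z': "Im (cnj z) \<noteq> 0" using z by simp
  have sw: "inner_L2 v (Gop (cnj z) \<alpha> w) = inner_L2 (Gop z \<alpha> v) w" if "L2 v" "L2 w" for v w
    by (rule inner_Gop[OF z that, symmetric])
  have e: "cnj (exp (- (\<i> * complex_of_real \<alpha>))) = exp (\<i> * complex_of_real \<alpha>)" by (simp add: exp_cnj)
  have s: "sgn (- Im z) = - sgn (Im z)" by (rule sgn_minus)
  note rules = gam_def Let_def complex_cnj_add complex_cnj_diff complex_cnj_mult complex_cnj_divide complex_cnj_i
    complex_cnj_numeral cnj_inner complex_cnj_cnj cnj_exp_i e Ev_eq_Gop sw[OF v1 v1] sw[OF v1 v2] sw[OF v2 v1] sw[OF v2 v2]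
    complex_cnj_complex_of_real complex_cnj_minus s
  from assms show ?thesis
    by (elim insertE emptyE; simp add: rules algebra_simps)
qed

lemma gamma_det_cnj: "cnj (gamma_det v1 v2 \<alpha> (cnj z)) = gamma_det v1 v2 \<alpha> z"
  unfolding gamma_det_def complex_cnj_diff complex_cnj_mult by (simp add: gam_cnj)

end

end

section \<open>Density of the domain\<close>

lemma interval_integral_shift:
  fixes f :: "real \<Rightarrow> complex"
  shows "(LBINT t=ereal (a + d)..ereal (x + d). f t) = (LBINT t=ereal a..ereal x. f (t + d))"
proof -
  have shift: "(LINT t:{a + d<..<x + d}|lborel. f t) = (LINT t:{a<..<x}|lborel. f (t + d))" for a x
  proof -
    have "(LINT t:{a + d<..<x + d}|lborel. f t)
        = (LINT t|lborel. indicator {a + d<..<x + d} (d + 1 * t) *\<^sub>R f (d + 1 * t))"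
      unfolding set_lebesgue_integral_def
      using lborel_integral_real_affine[of 1 "\<lambda>t. indicator {a + d<..<x + d} t *\<^sub>R f t" d] by simp
    also have "\<dots> = (LINT t:{a<..<x}|lborel. f (t + d))"
      unfolding set_lebesgue_integral_def
      by (intro Bochner_Integration.integral_cong) (auto simp: add.commute split: split_indicator)
    finally show ?thesis .
  qed
  show ?thesis unfolding interval_lebesgue_integral_def by (simp add: shift)
qed

text \<open>The means of f over intervals [x, x + d] are primitives of difference quotients and
  hence lie in \<open>W21\<close>. They converge almost everywhere by Lebesgue differentiation;
  boundedness and compact support of f, together with d \<le> 1, provide one dominating
  function.\<close>

lemma Steklov_approximation:
  assumes f: "L2 f" and B: "\<And>x. cmod (f x) \<le> B" and N: "\<And>x. N < \<bar>x\<bar> \<Longrightarrow> f x = 0" and "0 < e"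
  shows "\<exists>\<psi> \<phi>. W21 \<psi> \<phi> \<and> (LINT x|lborel. (cmod (\<psi> x - f x))\<^sup>2) < e"
proof -
  have [measurable]: "f \<in> borel_measurable borel" by (rule L2_measurable[OF f])
  have "0 \<le> B" using B[of 0] norm_ge_zero order_trans by blast
  define g where "g d x = (LBINT t=ereal x..ereal (x + d). f t) / complex_of_real d" for d x
  have W: "W21 (g d) (\<lambda>x. (f (x + d) - f x) / complex_of_real d)"
    and bound: "cmod (g d x) \<le> B * indicator {- N - 1..N + 1} x"
    and meas: "g d \<in> borel_measurable borel"
    if d: "0 < d" "d \<le> 1" for d x
  proof -
    define P where "P x = (LBINT t=ereal 0..ereal x. f t)" for x
    have P: "(LBINT t=ereal a..ereal x. f t) = P x - P a" for a x
      using interval_integral_L2_split[OF f, of 0 a x] by (simp add: P_def algebra_simps)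
    have gP: "g d x = (P (x + d) - P x) / complex_of_real d" for x
      by (simp add: g_def P)
    have contP: "continuous_on UNIV P"
    proof -
      have "isCont P x" for x
      proof -
        have "continuous_on {x - 1..x + 1} P"
          by (rule continuous_on_primitive[OF L2_set_integrable[OF f], where c = "P (x - 1)"]) (simp add: P)
        thus ?thesis by (rule continuous_on_interior) simp
      qed
      thus ?thesis by (simp add: continuous_at_imp_continuous_on)
    qed
    have "continuous_on UNIV (g d)"
      unfolding gP by (intro continuous_intros continuous_on_compose2[OF contP]) (use d in auto)
    thus m: "g d \<in> borel_measurable borel" by (rule borel_measurable_continuous_onI)
    have b: "cmod (g d x) \<le> B * indicator {- N - 1..N + 1} x" for x
    proof -
      have gI: "g d x = (LINT t:{x..x + d}|lborel. f t) / complex_of_real d"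
        using d by (simp add: g_def interval_integral_Icc)
      show ?thesis
      proof (cases "x \<in> {- N - 1..N + 1}")
        case True
        have "cmod (LINT t:{x..x + d}|lborel. f t) \<le> (LINT t:{x..x + d}|lborel. cmod (f t))"
          by (rule set_integral_norm_bound[OF L2_set_integrable[OF f]])
        also have "\<dots> \<le> (LINT t:{x..x + d}|lborel. B)"
        proof (rule set_integral_mono)
          show "set_integrable lborel {x..x + d} (\<lambda>t. cmod (f t))"
            by (rule set_integrable_norm[OF L2_set_integrable[OF f]])
          show "set_integrable lborel {x..x + d} (\<lambda>t. B)"
            by (intro borel_integrable_atLeastAtMost' continuous_intros)
        qed (rule B)
        also have "\<dots> = d * B" using d by (simp add: set_lebesgue_integral_def)
        finally show ?thesis using True d by (simp add: gI norm_divide field_simps)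
      next
        case False
        have "(LINT t:{x..x + d}|lborel. f t) = (LINT t:{x..x + d}|lborel. 0)"
          by (rule set_lebesgue_integral_cong) (use False d N in auto)
        thus ?thesis using False by (simp add: gI)
      qed
    qed
    thus "cmod (g d x) \<le> B * indicator {- N - 1..N + 1} x" .
    have fd: "L2 (\<lambda>x. f (x + d))"
      using L2_reflect[OF L2_diff_arg[OF f, of d]] by (simp add: add.commute)
    show "W21 (g d) (\<lambda>x. (f (x + d) - f x) / complex_of_real d)"
    proof (rule W21I)
      show "L2 (g d)"
      proof (rule L2_dominated[OF _ m])
        show "integrable lborel (\<lambda>x. B\<^sup>2 * indicator {- N - 1..N + 1} x)"
      by (intro integrable_mult_right integrable_indicator_Icc)
        show "(cmod (g d x))\<^sup>2 \<le> B\<^sup>2 * indicator {- N - 1..N + 1} x" for x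
          using power_mono[OF b[of x], of 2] by (simp add: power_mult_distrib split: split_indicator_asm split_indicator)
      qed
      show "L2 (\<lambda>x. (f (x + d) - f x) / complex_of_real d)"
        using L2_cmult[OF L2_diff[OF fd f], of "1 / complex_of_real d"] by simp
      fix a x :: real
      have "(LBINT t=ereal a..ereal x. (f (t + d) - f t) / complex_of_real d)
          = ((LBINT t=ereal a..ereal x. f (t + d)) - (LBINT t=ereal a..ereal x. f t)) / complex_of_real d"
        by (simp add: L2_interval_integrable fd f)
      also have "\<dots> = ((P (x + d) - P (a + d)) - (P x - P a)) / complex_of_real d"
        by (simp add: P flip: interval_integral_shift)
      finally show "g d x = g d a + (LBINT t=ereal a..ereal x. (f (t + d) - f t) / complex_of_real d)"
        by (simp add: gP diff_divide_distrib)
    qed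
  qed
  have "f integrable_on cbox a b" for a b
    using set_borel_integral_eq_integral(1)[OF L2_set_integrable[OF f, of a b]] by simp
  \<comment> \<open>Lebesgue differentiation in one-sided form: outside the null set
    \<open>M\<close> the means over [x, x + h] tend to \<open>f x\<close>.\<close>
  then obtain M where M: "negligible M" "\<And>x e. x \<notin> M \<Longrightarrow> 0 < e \<Longrightarrow>
      \<exists>d>0. \<forall>h. 0 < h \<and> h < d \<longrightarrow> norm (integral (cbox x (x + h *\<^sub>R One)) f /\<^sub>R h ^ DIM(real) - f x) < e"
    using integrable_ccontinuous_explicit[of f] by metis
  have lim: "((\<lambda>d. g d x) \<longlongrightarrow> f x) (at_right 0)" if xM: "x \<notin> M" for x
  proof (rule tendstoI)
    fix e :: real assume "0 < e"
    then obtain d where d: "d > 0" "\<And>h. 0 < h \<Longrightarrow> h < d \<Longrightarrow> norm (integral {x..x + h} f /\<^sub>R h - f x) < e"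
      using M(2)[OF xM, of e] by auto
    have "dist (g h x) (f x) < e" if h: "0 < h" "h < d" for h
    proof -
      have "g h x = integral {x..x + h} f /\<^sub>R h"
        using h by (simp add: g_def interval_integral_Icc set_borel_integral_eq_integral(2) L2_set_integrable f
            scaleR_conv_of_real divide_inverse mult.commute)
      thus ?thesis using d(2)[OF h] by (simp add: dist_norm)
    qed
    thus "eventually (\<lambda>h. dist (g h x) (f x) < e) (at_right 0)"
      using d(1) by (auto simp: eventually_at_right_field)
  qed
  define s where "s n = inverse (real (Suc n))" for n
  have s: "0 < s n" "s n \<le> 1" for n by (auto simp: s_def field_simps)
  have s_lim: "filterlim s (at_right 0) sequentially"
    unfolding filterlim_at using LIMSEQ_inverse_real_of_nat s by (auto simp: s_def[abs_def])
  have "(\<lambda>n. LINT x|lborel. (cmod (g (s n) x - f x))\<^sup>2) \<longlonglongrightarrow> integral\<^sup>L lborel (\<lambda>x::real. 0::real)"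
  proof (rule integral_dominated_convergence)
    show "integrable lborel (\<lambda>x. (2 * B)\<^sup>2 * indicator {- \<bar>N\<bar> - 1..\<bar>N\<bar> + 1} x)"
      by (intro integrable_mult_right integrable_indicator_Icc)
    show "(\<lambda>x. (cmod (g (s n) x - f x))\<^sup>2) \<in> borel_measurable lborel" for n
      using meas[OF s[of n]] by measurable
    have "AE x in lebesgue. x \<notin> M"
      using M(1) by (simp add: negligible_iff_null_sets AE_not_in)
    hence "AE x in lborel. x \<notin> M" by (simp add: AE_completion_iff)
    thus "AE x in lborel. (\<lambda>n. (cmod (g (s n) x - f x))\<^sup>2) \<longlonglongrightarrow> 0"
    proof eventually_elim
      case (elim x)
      have "(\<lambda>n. g (s n) x) \<longlonglongrightarrow> f x"
        by (rule filterlim_compose[OF lim[OF elim] s_lim])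
      hence "(\<lambda>n. (cmod (g (s n) x - f x))\<^sup>2) \<longlonglongrightarrow> (cmod (f x - f x))\<^sup>2"
        by (intro tendsto_intros)
      thus ?case by simp
    qed
    show "AE x in lborel. norm ((cmod (g (s n) x - f x))\<^sup>2) \<le> (2 * B)\<^sup>2 * indicator {- \<bar>N\<bar> - 1..\<bar>N\<bar> + 1} x" for n
    proof (rule AE_I2)
      fix x
      have "cmod (g (s n) x - f x) \<le> 2 * B * indicator {- \<bar>N\<bar> - 1..\<bar>N\<bar> + 1} x"
      proof (cases "x \<in> {- \<bar>N\<bar> - 1..\<bar>N\<bar> + 1}")
        case True
        have "cmod (g (s n) x) \<le> B"
          using bound[OF s[of n], of x] \<open>0 \<le> B\<close> by (cases "x \<in> {- N - 1..N + 1}") simp_all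
        thus ?thesis using True B[of x] norm_triangle_ineq4[of "g (s n) x" "f x"] by simp
      next
        case False
        hence "f x = 0" by (intro N) auto
        moreover have "g (s n) x = 0" using bound[OF s[of n], of x] False by (auto split: split_indicator_asm)
        ultimately show ?thesis using False by simp
      qed
      from power_mono[OF this, of 2]
      show "norm ((cmod (g (s n) x - f x))\<^sup>2) \<le> (2 * B)\<^sup>2 * indicator {- \<bar>N\<bar> - 1..\<bar>N\<bar> + 1} x"
        by (simp add: power_mult_distrib split: split_indicator_asm split_indicator)
    qed
  qed simp
  hence "eventually (\<lambda>n. (LINT x|lborel. (cmod (g (s n) x - f x))\<^sup>2) < e) sequentially"
    using \<open>0 < e\<close> by (intro order_tendstoD(2)) auto
  then obtain n where "(LINT x|lborel. (cmod (g (s n) x - f x))\<^sup>2) < e"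
    by (auto simp: eventually_sequentially)
  with W[OF s[of n]] show ?thesis by blast
qed

text \<open>Squared distances replace norms at the price of a factor 2, whence the
  \<open>e / 4\<close> for each of two approximation steps.\<close>

lemma L2_dist_triangle:
  assumes "L2 f" "L2 g" "L2 h"
  shows "(LINT x|lborel. (cmod (f x - h x))\<^sup>2)
    \<le> 2 * (LINT x|lborel. (cmod (f x - g x))\<^sup>2) + 2 * (LINT x|lborel. (cmod (g x - h x))\<^sup>2)"
proof -
  note i = L2_square_integrable[OF L2_diff[OF assms(1,2)]] L2_square_integrable[OF L2_diff[OF assms(2,3)]]
  have "(LINT x|lborel. (cmod (f x - h x))\<^sup>2)
      \<le> (LINT x|lborel. 2 * (cmod (f x - g x))\<^sup>2 + 2 * (cmod (g x - h x))\<^sup>2)"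
  proof (rule integral_mono)
    show "integrable lborel (\<lambda>x. (cmod (f x - h x))\<^sup>2)"
      by (rule L2_square_integrable[OF L2_diff[OF assms(1,3)]])
    show "integrable lborel (\<lambda>x. 2 * (cmod (f x - g x))\<^sup>2 + 2 * (cmod (g x - h x))\<^sup>2)"
      using i by simp
    show "(cmod (f x - h x))\<^sup>2 \<le> 2 * (cmod (f x - g x))\<^sup>2 + 2 * (cmod (g x - h x))\<^sup>2" for x
      using norm_add_square_le[of "f x - g x" "g x - h x"] by simp
  qed
  also have "\<dots> = 2 * (LINT x|lborel. (cmod (f x - g x))\<^sup>2) + 2 * (LINT x|lborel. (cmod (g x - h x))\<^sup>2)"
    using i by simp
  finally show ?thesis .
qed

text \<open>Truncating both the domain and the size of f produces a bounded function of compact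
  support, the input required by the Steklov means.\<close>

lemma W21_dense:
  assumes f: "L2 f" and "0 < e"
  shows "\<exists>\<psi> \<phi>. W21 \<psi> \<phi> \<and> (LINT x|lborel. (cmod (\<psi> x - f x))\<^sup>2) < e"
proof -
  have [measurable]: "f \<in> borel_measurable borel" by (rule L2_measurable[OF f])
  define t where "t n x = (if \<bar>x\<bar> \<le> real n \<and> cmod (f x) \<le> real n then f x else 0)" for n x
  have [measurable]: "t n \<in> borel_measurable borel" for n unfolding t_def by measurable
  have tL: "L2 (t n)" for n
    by (rule L2_dominated[OF L2_square_integrable[OF f]]) (auto simp: t_def)
  have "(\<lambda>n. LINT x|lborel. (cmod (t n x - f x))\<^sup>2) \<longlonglongrightarrow> integral\<^sup>L lborel (\<lambda>x::real. 0::real)"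
  proof (rule integral_dominated_convergence)
    show "integrable lborel (\<lambda>x. (cmod (f x))\<^sup>2)" by (rule L2_square_integrable[OF f])
    show "AE x in lborel. (\<lambda>n. (cmod (t n x - f x))\<^sup>2) \<longlonglongrightarrow> 0"
    proof (rule AE_I2)
      fix x
      obtain k where k: "max \<bar>x\<bar> (cmod (f x)) \<le> real k" using real_arch_simple by blast
      have "eventually (\<lambda>n. (cmod (t n x - f x))\<^sup>2 = 0) sequentially"
        using eventually_ge_at_top[of k] by eventually_elim (use k in \<open>auto simp: t_def\<close>)
      thus "(\<lambda>n. (cmod (t n x - f x))\<^sup>2) \<longlonglongrightarrow> 0" by (rule tendsto_eventually)
    qed
  qed (auto simp: t_def)
  hence "eventually (\<lambda>n. (LINT x|lborel. (cmod (t n x - f x))\<^sup>2) < e / 4) sequentially"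
    using \<open>0 < e\<close> by (intro order_tendstoD(2)) auto
  then obtain n where n: "(LINT x|lborel. (cmod (t n x - f x))\<^sup>2) < e / 4"
    by (auto simp: eventually_sequentially)
  have "cmod (t n x) \<le> real n" "real n < \<bar>x\<bar> \<Longrightarrow> t n x = 0" for x
    by (auto simp: t_def)
  moreover have "0 < e / 4" using \<open>0 < e\<close> by simp
  ultimately obtain \<psi> \<phi> where \<psi>: "W21 \<psi> \<phi>" "(LINT x|lborel. (cmod (\<psi> x - t n x))\<^sup>2) < e / 4"
    using Steklov_approximation[OF tL[of n]] by metis
  have "(LINT x|lborel. (cmod (\<psi> x - f x))\<^sup>2) < e"
    using L2_dist_triangle[OF W21_L2(1)[OF \<psi>(1)] tL[of n] f] n \<psi>(2) by linarith
  with \<psi>(1) show ?thesis by blast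
qed

text \<open>The boundary condition is an unbounded functional: it is corrected with the spikes
  \<open>gz (-n\<i>)\<close>, which have a fixed limit at \<open>+0\<close> but vanish in \<open>L\<^sub>2\<close> as \<open>n \<rightarrow> \<infinity>\<close>.\<close>
lemma A_graph_dense:
  assumes v1: "L2 v1" and v2: "L2 v2" and f: "L2 f" and "0 < e"
  shows "\<exists>(\<psi>, k)\<in>A_graph v1 v2 \<alpha>. (LINT x|lborel. (cmod (\<psi> x - f x))\<^sup>2) < e"
proof -
  \<comment> \<open>\<open>l\<close> measures the violation of the boundary condition; it is linear
    on \<open>W21\<close>, and its kernel there is the operator domain.\<close>
  define l where "l \<psi> = plus0 \<psi> - \<i> * inner_L2 \<psi> v2 - exp (\<i> * \<alpha>) * (minus0 \<psi> + \<i> * inner_L2 \<psi> v1)" for \<psi>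
  define \<eta> where "\<eta> n = gz (- \<i> * of_nat (Suc n))" for n
  have z: "Im (- \<i> * of_nat (Suc n)) < 0" for n by simp
  have z0: "Im (- \<i> * of_nat (Suc n)) \<noteq> 0" for n by simp
  note W\<eta> = W21_gz(1)[OF z0, folded \<eta>_def]
  have \<eta>L: "L2 (\<eta> n)" for n by (rule W21_L2(1)[OF W\<eta>])
  have [measurable]: "\<eta> n \<in> borel_measurable borel" "v1 \<in> borel_measurable borel" "v2 \<in> borel_measurable borel" for n
    using L2_measurable \<eta>L v1 v2 by auto
  have cm: "cmod (\<eta> n x) = (if x > 0 then exp (- (real (Suc n) * x)) else 0)" for n x
    unfolding \<eta>_def gz_neg[OF z] by (simp add: norm_mult norm_exp algebra_simps)
  have le: "cmod (\<eta> n x) \<le> cmod (\<eta> 0 x)" for n x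
    unfolding cm by simp
  have lim: "(\<lambda>n. \<eta> n x) \<longlonglongrightarrow> 0" for x
  proof (rule tendsto_norm_zero_cancel)
    show "(\<lambda>n. norm (\<eta> n x)) \<longlonglongrightarrow> 0"
    proof (cases "x > 0")
      case True
      have "filterlim (\<lambda>n. real (Suc n) * x) at_top sequentially"
        using True filterlim_compose[OF filterlim_real_sequentially filterlim_Suc]
        by (intro filterlim_at_top_mult_tendsto_pos[OF tendsto_const]) auto
      hence "(\<lambda>n. exp (- (real (Suc n) * x))) \<longlonglongrightarrow> 0"
        by (intro filterlim_compose[OF exp_at_bot]) (simp add: filterlim_uminus_at_bot)
      thus ?thesis using True by (simp add: cm)
    qed (simp add: cm)
  qed
  have inner_lim: "(\<lambda>n. inner_L2 (\<eta> n) v) \<longlonglongrightarrow> 0" if v: "L2 v" for v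
  proof -
    have [measurable]: "v \<in> borel_measurable borel" by (rule L2_measurable[OF v])
    have "(\<lambda>n. LINT x|lborel. \<eta> n x * cnj (v x)) \<longlonglongrightarrow> integral\<^sup>L lborel (\<lambda>x::real. 0::complex)"
    proof (rule integral_dominated_convergence)
      show "integrable lborel (\<lambda>x. cmod (\<eta> 0 x * cnj (v x)))"
        by (intro integrable_norm integrable_inner \<eta>L v)
      show "AE x in lborel. (\<lambda>n. \<eta> n x * cnj (v x)) \<longlonglongrightarrow> 0"
        using tendsto_mult_left_zero[OF lim] by simp
      show "AE x in lborel. cmod (\<eta> n x * cnj (v x)) \<le> cmod (\<eta> 0 x * cnj (v x))" for n
        unfolding norm_mult by (auto intro!: mult_right_mono le)
    qed auto
    thus ?thesis by (simp add: inner_L2_def)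
  qed
  have norm_lim: "(\<lambda>n. LINT x|lborel. (cmod (\<eta> n x))\<^sup>2) \<longlonglongrightarrow> 0"
  proof -
    have "(\<lambda>n. LINT x|lborel. (cmod (\<eta> n x))\<^sup>2) \<longlonglongrightarrow> integral\<^sup>L lborel (\<lambda>x::real. 0::real)"
    proof (rule integral_dominated_convergence[OF _ _ L2_square_integrable[OF \<eta>L[of 0]]])
      show "AE x in lborel. (\<lambda>n. (cmod (\<eta> n x))\<^sup>2) \<longlonglongrightarrow> 0"
      proof (rule AE_I2)
        fix x
        have "(\<lambda>n. (cmod (\<eta> n x))\<^sup>2) \<longlonglongrightarrow> (cmod 0)\<^sup>2" by (intro tendsto_intros lim)
        thus "(\<lambda>n. (cmod (\<eta> n x))\<^sup>2) \<longlonglongrightarrow> 0" by simp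
      qed
      show "AE x in lborel. norm ((cmod (\<eta> n x))\<^sup>2) \<le> (cmod (\<eta> 0 x))\<^sup>2" for n
        by (auto intro!: power_mono le)
    qed auto
    thus ?thesis by simp
  qed
  have l_lim: "(\<lambda>n. l (\<eta> n)) \<longlonglongrightarrow> - \<i>"
  proof -
    have "l (\<eta> n) = - \<i> - \<i> * inner_L2 (\<eta> n) v2 - exp (\<i> * \<alpha>) * (0 + \<i> * inner_L2 (\<eta> n) v1)" for n
      unfolding l_def \<eta>_def W21_gz(2,3)[OF z0] by simp
    moreover have "(\<lambda>n. - \<i> - \<i> * inner_L2 (\<eta> n) v2 - exp (\<i> * \<alpha>) * (0 + \<i> * inner_L2 (\<eta> n) v1))
        \<longlonglongrightarrow> - \<i> - \<i> * 0 - exp (\<i> * \<alpha>) * (0 + \<i> * 0)"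
      by (intro tendsto_intros inner_lim v1 v2)
    ultimately show ?thesis by simp
  qed
  obtain \<psi> \<phi> where \<psi>: "W21 \<psi> \<phi>" "(LINT x|lborel. (cmod (\<psi> x - f x))\<^sup>2) < e / 4"
    using W21_dense[OF f, of "e / 4"] \<open>0 < e\<close> by auto
  \<comment> \<open>This choice cancels the defect of \<psi>. Since \<open>l (\<eta> n)\<close>
    tends to -i, the coefficients stay bounded while the norms of the spikes tend to 0.\<close>
  define c where "c n = - l \<psi> / l (\<eta> n)" for n
  have "(\<lambda>n. (cmod (c n))\<^sup>2 * (LINT x|lborel. (cmod (\<eta> n x))\<^sup>2)) \<longlonglongrightarrow> (cmod (- l \<psi> / - \<i>))\<^sup>2 * 0"
    unfolding c_def by (intro tendsto_intros l_lim norm_lim) auto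
  hence "eventually (\<lambda>n. (cmod (c n))\<^sup>2 * (LINT x|lborel. (cmod (\<eta> n x))\<^sup>2) < e / 4) sequentially"
    using \<open>0 < e\<close> by (intro order_tendstoD(2)) auto
  moreover have "eventually (\<lambda>n. l (\<eta> n) \<noteq> 0) sequentially"
    using tendsto_imp_eventually_ne[OF l_lim] by simp
  ultimately have "eventually (\<lambda>n. (cmod (c n))\<^sup>2 * (LINT x|lborel. (cmod (\<eta> n x))\<^sup>2) < e / 4 \<and> l (\<eta> n) \<noteq> 0) sequentially"
    by eventually_elim simp
  then obtain n where n: "(cmod (c n))\<^sup>2 * (LINT x|lborel. (cmod (\<eta> n x))\<^sup>2) < e / 4" "l (\<eta> n) \<noteq> 0"
    by (auto simp: eventually_sequentially)
  define \<psi>' where "\<psi>' = (\<lambda>x. \<psi> x + c n * \<eta> n x)"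
  note k = W21_cmult[OF W\<eta>[of n], of "c n"]
  note s = W21_add[OF \<psi>(1) k(1), folded \<psi>'_def]
  have inner: "inner_L2 \<psi>' v = inner_L2 \<psi> v + c n * inner_L2 (\<eta> n) v" if "L2 v" for v
    unfolding \<psi>'_def inner_add_left[OF W21_L2(1)[OF \<psi>(1)] W21_L2(1)[OF k(1)] that] inner_cmult_left ..
  have "l \<psi>' = l \<psi> + c n * l (\<eta> n)"
    unfolding l_def s(2,3) k(2,3) inner[OF v1] inner[OF v2] by (simp add: algebra_simps)
  also have "\<dots> = 0" using n(2) by (simp add: c_def)
  finally have "plus0 \<psi>' - \<i> * inner_L2 \<psi>' v2 = exp (\<i> * \<alpha>) * (minus0 \<psi>' + \<i> * inner_L2 \<psi>' v1)"
    by (simp add: l_def)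
  with s(1) have "\<exists>k. (\<psi>', k) \<in> A_graph v1 v2 \<alpha>"
    unfolding A_graph_def by blast
  moreover have "(LINT x|lborel. (cmod (\<psi>' x - f x))\<^sup>2) < e"
  proof -
    have "(LINT x|lborel. (cmod (\<psi>' x - \<psi> x))\<^sup>2) = (cmod (c n))\<^sup>2 * (LINT x|lborel. (cmod (\<eta> n x))\<^sup>2)"
      by (simp add: \<psi>'_def norm_mult power_mult_distrib)
    with L2_dist_triangle[OF W21_L2(1)[OF s(1)] W21_L2(1)[OF \<psi>(1)] f] n(1) \<psi>(2) show ?thesis
      by linarith
  qed
  ultimately show ?thesis by blast
qed

section \<open>Self-adjointness\<close>

lemma A_graph_L2:
  assumes "L2 v1" "L2 v2" "(f, k) \<in> A_graph v1 v2 \<alpha>"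
  shows "L2 f" "L2 k"
proof -
  obtain \<phi> where \<phi>: "W21 f \<phi>"
    "k = (\<lambda>x. \<i> * \<phi> x + v1 x * avg1 v1 f + v2 x * avg2 v2 f)"
    using assms(3) unfolding A_graph_def avg1_def avg2_def by blast
  show "L2 f" by (rule W21_L2(1)[OF \<phi>(1)])
  have "L2 (\<lambda>x. \<i> * \<phi> x + avg1 v1 f * v1 x + avg2 v2 f * v2 x)"
    by (intro L2_add L2_cmult W21_L2(2)[OF \<phi>(1)] assms)
  thus "L2 k" unfolding \<phi>(2) by (simp add: mult.commute)
qed

text \<open>Surjectivity of \<open>A + \<i>\<close> and \<open>A - \<i>\<close> turns the symmetric operator into a self-adjoint one.\<close>
lemma adjoint_subset:
  assumes v: "L2 v1" "L2 v2" and gh: "(g, h) \<in> adjoint_rel (A_graph v1 v2 \<alpha>)"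
  shows "\<exists>(f, k)\<in>A_graph v1 v2 \<alpha>. ae_eq f g \<and> ae_eq k h"
proof -
  have g: "L2 g" and h: "L2 h"
    and adj: "\<And>f k. (f, k) \<in> A_graph v1 v2 \<alpha> \<Longrightarrow> inner_L2 k g = inner_L2 f h"
    using gh by (auto simp: adjoint_rel_def)
  \<comment> \<open>If (g, h) came from A, this would be (A - i) g. Solving (A - i) f = r in the
    domain produces the candidate f for g.\<close>
  define r where "r x = h x - \<i> * g x" for x
  have r: "L2 r" unfolding r_def by (intro L2_diff L2_cmult g h)
  have i: "Im \<i> \<noteq> 0" "Im (- \<i>) \<noteq> 0" by simp_all
  obtain f where f: "(f, \<lambda>x. r x + \<i> * f x) \<in> A_graph v1 v2 \<alpha>"
    using resolvent_kernel(2)[OF v i(1) r] by blast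
  have fL: "L2 f" by (rule A_graph_L2(1)[OF v f])
  define w where "w x = g x - f x" for x
  have w: "L2 w" unfolding w_def by (intro L2_diff g fL)
  \<comment> \<open>The difference w is orthogonal to the range of A + i. Choosing u with (A + i) u
    = w makes w orthogonal to itself.\<close>
  obtain u where u: "(u, \<lambda>x. w x + - \<i> * u x) \<in> A_graph v1 v2 \<alpha>"
    using resolvent_kernel(2)[OF v i(2) w] by blast
  have uL: "L2 u" by (rule A_graph_L2(1)[OF v u])
  have iu: "L2 (\<lambda>x. - \<i> * u x)" by (rule L2_cmult[OF uL])
  have wu: "L2 (\<lambda>x. w x + - \<i> * u x)" by (intro L2_add w iu)
  have "inner_L2 (\<lambda>x. w x + - \<i> * u x) w = inner_L2 (\<lambda>x. w x + - \<i> * u x) g - inner_L2 (\<lambda>x. w x + - \<i> * u x) f"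
    using inner_diff_right[OF g fL wu] by (simp add: w_def[abs_def])
  also have "\<dots> = inner_L2 u h - inner_L2 u (\<lambda>x. r x + \<i> * f x)"
    using adj[OF u] A_graph_symmetric[OF v u f] by simp
  also have "\<dots> = inner_L2 u (\<lambda>x. h x - (r x + \<i> * f x))"
    by (rule inner_diff_right[symmetric]) (intro h L2_add r L2_cmult fL uL)+
  also have "(\<lambda>x. h x - (r x + \<i> * f x)) = (\<lambda>x. \<i> * w x)"
    by (auto simp: r_def w_def algebra_simps)
  also have "inner_L2 u (\<lambda>x. \<i> * w x) = - \<i> * inner_L2 u w"
    by (simp add: inner_cmult_right)
  finally have "inner_L2 w w = 0"
    unfolding inner_add_left[OF w iu w] inner_cmult_left by simp
  hence w0: "ae_eq w (\<lambda>x. 0)" by (rule ae_eq_zero_if_inner_self_zero[OF w])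
  have "ae_eq f g"
    using w0 unfolding ae_eq_def w_def by eventually_elim simp
  moreover have "ae_eq (\<lambda>x. r x + \<i> * f x) h"
    using w0 unfolding ae_eq_def w_def r_def by eventually_elim simp
  ultimately show ?thesis using f by blast
qed

lemma A_graph_self_adjoint:
  assumes v: "L2 v1" "L2 v2"
  shows "self_adjoint_rel (A_graph v1 v2 \<alpha>)"
  unfolding self_adjoint_rel_def
proof (intro conjI)
  show "\<forall>(f, k)\<in>A_graph v1 v2 \<alpha>. L2 f \<and> L2 k"
    using A_graph_L2[OF v] by blast
  show "\<forall>g. L2 g \<longrightarrow> (\<forall>e>0. \<exists>(f, k)\<in>A_graph v1 v2 \<alpha>. (LINT x|lborel. (cmod (f x - g x))\<^sup>2) < e)"
    using A_graph_dense[OF v] by blast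
  show "A_graph v1 v2 \<alpha> \<subseteq> adjoint_rel (A_graph v1 v2 \<alpha>)"
    unfolding adjoint_rel_def using A_graph_L2[OF v] A_graph_symmetric[OF v] by blast
  show "\<forall>(g, h)\<in>adjoint_rel (A_graph v1 v2 \<alpha>). \<exists>(f, k)\<in>A_graph v1 v2 \<alpha>. ae_eq f g \<and> ae_eq k h"
    using adjoint_subset[OF v] by blast
qed

theorem theorem3p4:
  fixes v1 v2 :: "real \<Rightarrow> complex" and \<alpha> :: real
  assumes "L2 v1" and "L2 v2" and "0 \<le> \<alpha>" and "\<alpha> < 2 * pi"
  shows "self_adjoint_rel (A_graph v1 v2 \<alpha>) \<and>
    (\<forall>z. Im z \<noteq> 0 \<longrightarrow>
       (\<forall>f. L2 f \<longrightarrow>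
          (\<forall>x. integrable lborel (\<lambda>y. Gk_pert v1 v2 \<alpha> z x y * f y)) \<and>
          (\<exists>(psi, chi)\<in>A_graph v1 v2 \<alpha>.
             ae_eq psi (\<lambda>x. LINT y|lborel. Gk_pert v1 v2 \<alpha> z x y * f y) \<and>
             ae_eq (\<lambda>x. chi x - z * psi x) f)) \<and>
       (\<forall>j\<in>{1,2}. \<forall>k\<in>{1,2}. cnj (gam v1 v2 \<alpha> k j (cnj z)) = gam v1 v2 \<alpha> j k z) \<and>
       cnj (gamma_det v1 v2 \<alpha> (cnj z)) = gamma_det v1 v2 \<alpha> z \<and>
       gamma_det v1 v2 \<alpha> z \<noteq> 0)"
proof (intro conjI allI impI)
  note v = assms(1,2)
  show "self_adjoint_rel (A_graph v1 v2 \<alpha>)" by (rule A_graph_self_adjoint[OF v])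
  fix z assume z: "Im z \<noteq> 0"
  show "\<forall>j\<in>{1,2}. \<forall>k\<in>{1,2}. cnj (gam v1 v2 \<alpha> k j (cnj z)) = gam v1 v2 \<alpha> j k z"
    using gam_cnj[OF v z] by blast
  show "cnj (gamma_det v1 v2 \<alpha> (cnj z)) = gamma_det v1 v2 \<alpha> z" by (rule gamma_det_cnj[OF v z])
  show "gamma_det v1 v2 \<alpha> z \<noteq> 0" by (rule gamma_det_nonzero[OF v z])
  fix f assume f: "L2 f"
  show "integrable lborel (\<lambda>y. Gk_pert v1 v2 \<alpha> z x y * f y)" for x
    by (rule resolvent_kernel(1)[OF v z f])
  show "\<exists>(psi, chi)\<in>A_graph v1 v2 \<alpha>.
      ae_eq psi (\<lambda>x. LINT y|lborel. Gk_pert v1 v2 \<alpha> z x y * f y) \<and> ae_eq (\<lambda>x. chi x - z * psi x) f"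
    by (rule bexI[OF _ resolvent_kernel(2)[OF v z f]]) (simp add: ae_eq_def)
qed

end
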